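(* Let $\mathcal{I}$ be a finite sets interpretation whose output signature contains a binary symbol $\sim$. Then there exists a finite sets interpretation $\mathcal{I}'$ such that for every tree $t$ (over the input signature of $\mathcal{I}$) for which the interpretation of $\sim$ in $\mathcal{I}(t)$ is a congruence, the structure $\mathcal{I}'(t)$ is isomorphic to the quotient $\mathcal{I}(t)/_{\sim}$.
   Context: A tree labeled by a finite alphabet $\Sigma$ is a partial mapping $t:\{0,1\}^*\to\Sigma$ with prefix-closed domain $\mathit{dom}(t)$ such that $u1\in\mathit{dom}(t)$ implies $u0\in\mathit{dom}(t)$. As a structure, $t$ has universe $\mathit{dom}(t)$, binary relations $S_0,S_1$ with $S_i(u,v)$ iff $v=ui$, and for each $a\in\Sigma$ a unary predicate for $\{u:t(u)=a\}$. WMSO is MSO with set variables ranging over finite sets. A finite sets interpretation is a tuple $(\delta,\Phi_{R_1},\dots,\Phi_{R_N})$ of WMSO formulas, $\delta$ with one free set variable and $\Phi_{R_i}$ with $r_i$ free set variables; $\mathcal{I}(\mathcal{S})$ has as universe the finite subsets $U$ of the universe of $\mathcal{S}$ with $\mathcal{S}\models\delta(U)$, and $R_i$ is interpreted as the tuples of such sets satisfying $\Phi_{R_i}$ in $\mathcal{S}$. A congruence on a structure is an equivalence relation $\sim$ such that for every relation symbol $R$ of arity $n$, $x_1\sim y_1,\dots,x_n\sim y_n$ implies ($R(x_1,\dots,x_n)$ iff $R(y_1,\dots,y_n)$). The quotient $\mathcal{S}/_\sim$ has as elements the $\sim$-classes, and its relations are the images of those of $\mathcal{S}$ under the canonical surjection.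 *)

theory Defs
  imports "HOL-Library.Sublist"
begin

section \<open>Relational signatures and structures\<close>

record 'r signature =
  symbols :: "'r set"
  arity :: "'r \<Rightarrow> nat"

record ('r, 'u) rel_struct =
  universe :: "'u set"
  interp :: "'r \<Rightarrow> 'u list set"

definition tuples :: "nat \<Rightarrow> 'u set \<Rightarrow> 'u list set" where
  "tuples n A = {xs. length xs = n \<and> set xs \<subseteq> A}"

definition isomorphic :: "'r signature \<Rightarrow> ('r, 'u) rel_struct \<Rightarrow> ('r, 'v) rel_struct \<Rightarrow> bool" where
  "isomorphic \<tau> A B \<longleftrightarrow> (\<exists>f. bij_betw f (universe A) (universe B) \<and>
     (\<forall>R\<in>symbols \<tau>. \<forall>xs\<in>tuples (arity \<tau> R) (universe A).
        xs \<in> interp A R \<longleftrightarrow> map f xs \<in> interp B R))"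

definition congruence :: "'r signature \<Rightarrow> ('r, 'u) rel_struct \<Rightarrow> ('u \<times> 'u) set \<Rightarrow> bool" where
  "congruence \<tau> A E \<longleftrightarrow> equiv (universe A) E \<and>
     (\<forall>R\<in>symbols \<tau>. \<forall>xs\<in>tuples (arity \<tau> R) (universe A). \<forall>ys\<in>tuples (arity \<tau> R) (universe A).
        list_all2 (\<lambda>x y. (x, y) \<in> E) xs ys \<longrightarrow> (xs \<in> interp A R \<longleftrightarrow> ys \<in> interp A R))"

definition quotient_struct :: "('r, 'u) rel_struct \<Rightarrow> ('u \<times> 'u) set \<Rightarrow> ('r, 'u set) rel_struct" where
  "quotient_struct A E =
     \<lparr> universe = universe A // E,
       interp = (\<lambda>R. map (\<lambda>x. E `` {x}) ` interp A R) \<rparr>"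

definition binary_rel :: "('r, 'u) rel_struct \<Rightarrow> 'r \<Rightarrow> ('u \<times> 'u) set" where
  "binary_rel A R = {(x, y). [x, y] \<in> interp A R}"


section \<open>Weak monadic second-order logic\<close>

text \<open>Element variables and set variables form two separate copies of the natural numbers.
  The remaining connectives and the universal quantifiers are definable from these.\<close>

datatype 'r wmso =
    Rel 'r "nat list"
  | Eq nat nat
  | Mem nat nat  \<comment> \<open>element variable first, set variable second\<close>
  | Neg "'r wmso"
  | Conj "'r wmso" "'r wmso"
  | ExElem nat "'r wmso"
  | ExSet nat "'r wmso"

primrec free_elem_vars :: "'r wmso \<Rightarrow> nat set" where
  "free_elem_vars (Rel R xs) = set xs"
| "free_elem_vars (Eq x y) = {x, y}"
| "free_elem_vars (Mem x X) = {x}"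
| "free_elem_vars (Neg \<phi>) = free_elem_vars \<phi>"
| "free_elem_vars (Conj \<phi> \<psi>) = free_elem_vars \<phi> \<union> free_elem_vars \<psi>"
| "free_elem_vars (ExElem x \<phi>) = free_elem_vars \<phi> - {x}"
| "free_elem_vars (ExSet X \<phi>) = free_elem_vars \<phi>"

primrec free_set_vars :: "'r wmso \<Rightarrow> nat set" where
  "free_set_vars (Rel R xs) = {}"
| "free_set_vars (Eq x y) = {}"
| "free_set_vars (Mem x X) = {X}"
| "free_set_vars (Neg \<phi>) = free_set_vars \<phi>"
| "free_set_vars (Conj \<phi> \<psi>) = free_set_vars \<phi> \<union> free_set_vars \<psi>"
| "free_set_vars (ExElem x \<phi>) = free_set_vars \<phi>"
| "free_set_vars (ExSet X \<phi>) = free_set_vars \<phi> - {X}"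

primrec wf_wmso :: "'r signature \<Rightarrow> 'r wmso \<Rightarrow> bool" where
  "wf_wmso \<sigma> (Rel R xs) \<longleftrightarrow> R \<in> symbols \<sigma> \<and> length xs = arity \<sigma> R"
| "wf_wmso \<sigma> (Eq x y) \<longleftrightarrow> True"
| "wf_wmso \<sigma> (Mem x X) \<longleftrightarrow> True"
| "wf_wmso \<sigma> (Neg \<phi>) \<longleftrightarrow> wf_wmso \<sigma> \<phi>"
| "wf_wmso \<sigma> (Conj \<phi> \<psi>) \<longleftrightarrow> wf_wmso \<sigma> \<phi> \<and> wf_wmso \<sigma> \<psi>"
| "wf_wmso \<sigma> (ExElem x \<phi>) \<longleftrightarrow> wf_wmso \<sigma> \<phi>"
| "wf_wmso \<sigma> (ExSet X \<phi>) \<longleftrightarrow> wf_wmso \<sigma> \<phi>"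

primrec sat :: "('r, 'u) rel_struct \<Rightarrow> (nat \<Rightarrow> 'u) \<Rightarrow> (nat \<Rightarrow> 'u set) \<Rightarrow> 'r wmso \<Rightarrow> bool" where
  "sat A e s (Rel R xs) \<longleftrightarrow> map e xs \<in> interp A R"
| "sat A e s (Eq x y) \<longleftrightarrow> e x = e y"
| "sat A e s (Mem x X) \<longleftrightarrow> e x \<in> s X"
| "sat A e s (Neg \<phi>) \<longleftrightarrow> \<not> sat A e s \<phi>"
| "sat A e s (Conj \<phi> \<psi>) \<longleftrightarrow> sat A e s \<phi> \<and> sat A e s \<psi>"
| "sat A e s (ExElem x \<phi>) \<longleftrightarrow> (\<exists>u\<in>universe A. sat A (e(x := u)) s \<phi>)"
| "sat A e s (ExSet X \<phi>) \<longleftrightarrow> (\<exists>U. finite U \<and> U \<subseteq> universe A \<and> sat A e (s(X := U)) \<phi>)"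

lemma sat_cong_free_vars:
  assumes "\<And>x. x \<in> free_elem_vars \<phi> \<Longrightarrow> e x = e' x"
    and "\<And>X. X \<in> free_set_vars \<phi> \<Longrightarrow> s X = s' X"
  shows "sat A e s \<phi> \<longleftrightarrow> sat A e' s' \<phi>"
  using assms
proof (induction \<phi> arbitrary: e e' s s')
  case (Rel R xs)
  then have "map e xs = map e' xs" by simp
  then show ?case by (simp only: sat.simps)
next
  case (Conj \<phi> \<psi>)
  have "sat A e s \<phi> \<longleftrightarrow> sat A e' s' \<phi>"
    by (rule Conj.IH(1)) (use Conj.prems in auto)
  moreover have "sat A e s \<psi> \<longleftrightarrow> sat A e' s' \<psi>"
    by (rule Conj.IH(2)) (use Conj.prems in auto)
  ultimately show ?case by simp
next
  case (ExElem x \<phi>)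
  have "sat A (e(x := u)) s \<phi> \<longleftrightarrow> sat A (e'(x := u)) s' \<phi>" for u
    by (rule ExElem.IH) (use ExElem.prems in auto)
  then show ?case by simp
next
  case (ExSet X \<phi>)
  have "sat A e (s(X := U)) \<phi> \<longleftrightarrow> sat A e' (s'(X := U)) \<phi>" for U
    by (rule ExSet.IH) (use ExSet.prems in auto)
  then show ?case by simp
next
  case (Neg \<phi>)
  have "sat A e s \<phi> \<longleftrightarrow> sat A e' s' \<phi>"
    by (rule Neg.IH) (use Neg.prems in auto)
  then show ?case by simp
qed simp_all

text \<open>A formula with \<open>n\<close> free set variables is one whose free variables are among the set
  variables \<open>0, \<dots>, n - 1\<close>; the \<open>i\<close>-th argument is the value of the set variable \<open>i\<close>.  By
  \<open>sat_cong_free_vars\<close> the remaining values used in \<open>holds\<close> do not matter.\<close>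

definition set_formula :: "'r signature \<Rightarrow> nat \<Rightarrow> 'r wmso \<Rightarrow> bool" where
  "set_formula \<sigma> n \<phi> \<longleftrightarrow> wf_wmso \<sigma> \<phi> \<and> free_elem_vars \<phi> = {} \<and> free_set_vars \<phi> \<subseteq> {..<n}"

definition holds :: "('r, 'u) rel_struct \<Rightarrow> 'u set list \<Rightarrow> 'r wmso \<Rightarrow> bool" where
  "holds A Us \<phi> \<longleftrightarrow> sat A (\<lambda>_. undefined) (\<lambda>i. if i < length Us then Us ! i else {}) \<phi>"


section \<open>Finite sets interpretations\<close>

record ('i, 'o) fs_interp =
  dom_formula :: "'i wmso"
  rel_formula :: "'o \<Rightarrow> 'i wmso"

definition finite_sets_interpretation ::
  "'i signature \<Rightarrow> 'o signature \<Rightarrow> ('i, 'o) fs_interp \<Rightarrow> bool" where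
  "finite_sets_interpretation \<sigma> \<tau> I \<longleftrightarrow> finite (symbols \<tau>) \<and>
     set_formula \<sigma> 1 (dom_formula I) \<and>
     (\<forall>R\<in>symbols \<tau>. set_formula \<sigma> (arity \<tau> R) (rel_formula I R))"

definition fs_universe :: "('i, 'o) fs_interp \<Rightarrow> ('i, 'u) rel_struct \<Rightarrow> 'u set set" where
  "fs_universe I A = {U. finite U \<and> U \<subseteq> universe A \<and> holds A [U] (dom_formula I)}"

definition apply_interp ::
  "'o signature \<Rightarrow> ('i, 'o) fs_interp \<Rightarrow> ('i, 'u) rel_struct \<Rightarrow> ('o, 'u set) rel_struct" where
  "apply_interp \<tau> I A =
     \<lparr> universe = fs_universe I A,
       interp = (\<lambda>R. {Us \<in> tuples (arity \<tau> R) (fs_universe I A). holds A Us (rel_formula I R)}) \<rparr>"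


section \<open>Labeled trees\<close>

text \<open>A node is a word over \<open>{0, 1}\<close>, with \<open>False\<close> for 0 and \<open>True\<close> for 1; the root is \<open>[]\<close>.
  Trees may be infinite, and the empty tree is included.\<close>

type_synonym 'a tree = "bool list \<rightharpoonup> 'a"

definition is_tree :: "'a set \<Rightarrow> 'a tree \<Rightarrow> bool" where
  "is_tree \<Sigma> t \<longleftrightarrow> ran t \<subseteq> \<Sigma> \<and>
     (\<forall>v\<in>dom t. \<forall>u. prefix u v \<longrightarrow> u \<in> dom t) \<and>
     (\<forall>u. u @ [True] \<in> dom t \<longrightarrow> u @ [False] \<in> dom t)"

datatype 'a tree_sym = Succ bool | Label 'a

definition tree_signature :: "'a set \<Rightarrow> 'a tree_sym signature" where
  "tree_signature \<Sigma> =
     \<lparr> symbols = range Succ \<union> Label ` \<Sigma>,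
       arity = (\<lambda>R. case R of Succ _ \<Rightarrow> 2 | Label _ \<Rightarrow> 1) \<rparr>"

definition tree_struct :: "'a tree \<Rightarrow> ('a tree_sym, bool list) rel_struct" where
  "tree_struct t =
     \<lparr> universe = dom t,
       interp = (\<lambda>R. case R of
           Succ i \<Rightarrow> {[u, v] | u v. u \<in> dom t \<and> v \<in> dom t \<and> v = u @ [i]}
         | Label a \<Rightarrow> {[u] | u. t u = Some a}) \<rparr>"

end

theory Submission
  imports Defs "HOL-Library.List_Lexorder"
begin

text \<open>An equivalence class of finite sets may have no definable member, since infinite trees need not
  admit definable choice.  So a class is represented by a code rather than by one of its members.
  Let \<open>u\<close> be a node with infinite subtree.  If the class of \<open>X\<close> has a member \<open>Y\<close> avoiding the subtree
  at \<open>u\<close>, then by composition the class of \<open>X\<close> depends on the part of \<open>X\<close> below \<open>u\<close> only through one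
  of finitely many definable types.  The topmost such nodes form a finite border determined by the
  class, and the nodes not below the border form a finite set.  A code keeps \<open>X\<close> there and replaces
  the part below each border node \<open>u\<close> by \<open>u\<close> together with one node strictly below \<open>u\<close> whose depth
  gives the type.  The border can be read off a code (nodes of the code with infinite
  subtree containing exactly two elements of the code), so codes determine the class, and each class
  has only finitely many codes, among which the least in a definable linear order is chosen.\<close>

section \<open>Definable properties of valuations\<close>

text \<open>The avoiding member \<open>Y\<close> is what makes a type of \<open>X\<close> alone
  sufficient. Deciding by composition whether \<open>X\<close> and \<open>Y\<close> are equivalent
  requires in general their joint type below \<open>u\<close>; once \<open>Y\<close> is empty there,
  the joint type reduces to that of \<open>X\<close>. The border is finite because \<open>X\<close>
  is finite: \<open>X\<close> itself avoids every infinite subtree that it does not meet. Only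
  infinite subtrees are cut off, since a finite one may lack a node deep enough to encode the type;
  outside the cut-off part finite subtrees cause no harm and are kept verbatim. Equivalent sets may
  have different types at a border node, so a class can have several codes. That they are finitely
  many is essential for choosing the least one: the definable order on finite sets has infinite
  descending chains, such as the singletons of the nodes 1, 01, 001, and so on.\<close>

definition valuation :: "'a tree \<Rightarrow> (nat \<Rightarrow> bool list) \<Rightarrow> (nat \<Rightarrow> bool list set) \<Rightarrow> bool" where
  "valuation t e s \<longleftrightarrow> (\<forall>i. e i \<in> dom t) \<and> (\<forall>i. finite (s i) \<and> s i \<subseteq> dom t)"

text \<open>A semantic notion, so that closure rules replace the writing of formulas. One formula
  must serve all trees at once. Agreement is demanded only on nodes and finite sets of nodes, the
  only values that quantifiers produce.\<close>

definition definable ::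
  "'a set \<Rightarrow> ('a tree \<Rightarrow> (nat \<Rightarrow> bool list) \<Rightarrow> (nat \<Rightarrow> bool list set) \<Rightarrow> bool) \<Rightarrow> bool" where
  "definable \<Sigma> P \<longleftrightarrow> (\<exists>\<phi>. wf_wmso (tree_signature \<Sigma>) \<phi> \<and>
     (\<forall>t e s. is_tree \<Sigma> t \<longrightarrow> valuation t e s \<longrightarrow> (sat (tree_struct t) e s \<phi> \<longleftrightarrow> P t e s)))"

lemma definableI:
  assumes "wf_wmso (tree_signature \<Sigma>) \<phi>"
    and "\<And>t e s. is_tree \<Sigma> t \<Longrightarrow> valuation t e s \<Longrightarrow> sat (tree_struct t) e s \<phi> \<longleftrightarrow> P t e s"
  shows "definable \<Sigma> P"
  using assms unfolding definable_def by blast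

lemma definable_cong:
  assumes "definable \<Sigma> Q"
    and "\<And>t e s. is_tree \<Sigma> t \<Longrightarrow> valuation t e s \<Longrightarrow> P t e s \<longleftrightarrow> Q t e s"
  shows "definable \<Sigma> P"
  using assms unfolding definable_def by blast

lemma universe_tree_struct [simp]: "universe (tree_struct t) = dom t"
  by (simp add: tree_struct_def)

section \<open>Renaming and quantifying variables\<close>

lemma finite_free_elem_vars: "finite (free_elem_vars \<phi>)"
  by (induction \<phi>) auto

lemma finite_free_set_vars: "finite (free_set_vars \<phi>)"
  by (induction \<phi>) auto

lemma fresh_nat: "finite A \<Longrightarrow> \<exists>z::nat. z \<notin> A"
  by (rule ex_new_if_finite) auto

text \<open>Capture is the only danger: a bound variable is moved to a \<open>z\<close> outside the
  image of the free variables of the body. Neither map has to be injective, which matters when a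
  variable is identified with the root of a subtree.\<close>

lemma rename_wmso:
  "\<exists>\<psi>. wf_wmso \<sigma> \<psi> = wf_wmso \<sigma> \<phi> \<and>
     (\<forall>A :: ('r, 'u) rel_struct. \<forall>e s. sat A e s \<psi> \<longleftrightarrow> sat A (\<lambda>i. e (f i)) (\<lambda>i. s (g i)) \<phi>)"
proof (induction \<phi> arbitrary: f g)
  case (Rel R xs)
  show ?case by (rule exI[of _ "Rel R (map f xs)"]) (simp add: comp_def)
next
  case (Eq x y)
  show ?case by (rule exI[of _ "Eq (f x) (f y)"]) simp
next
  case (Mem x X)
  show ?case by (rule exI[of _ "Mem (f x) (g X)"]) simp
next
  case (Neg \<phi>)
  from Neg[of f g] obtain \<psi> where "wf_wmso \<sigma> \<psi> = wf_wmso \<sigma> \<phi>"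
    "\<And>(A :: ('r, 'u) rel_struct) e s. sat A e s \<psi> \<longleftrightarrow> sat A (\<lambda>i. e (f i)) (\<lambda>i. s (g i)) \<phi>" by blast
  then show ?case by (intro exI[of _ "wmso.Neg \<psi>"]) simp
next
  case (Conj \<phi>1 \<phi>2)
  from Conj(1)[of f g] obtain \<psi>1 where 1: "wf_wmso \<sigma> \<psi>1 = wf_wmso \<sigma> \<phi>1"
    "\<And>(A :: ('r, 'u) rel_struct) e s. sat A e s \<psi>1 \<longleftrightarrow> sat A (\<lambda>i. e (f i)) (\<lambda>i. s (g i)) \<phi>1" by blast
  from Conj(2)[of f g] obtain \<psi>2 where 2: "wf_wmso \<sigma> \<psi>2 = wf_wmso \<sigma> \<phi>2"
    "\<And>(A :: ('r, 'u) rel_struct) e s. sat A e s \<psi>2 \<longleftrightarrow> sat A (\<lambda>i. e (f i)) (\<lambda>i. s (g i)) \<phi>2" by blast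
  from 1 2 show ?case by (intro exI[of _ "wmso.Conj \<psi>1 \<psi>2"]) simp
next
  case (ExElem x \<phi>)
  obtain z where z: "z \<notin> f ` free_elem_vars \<phi>"
    using fresh_nat finite_free_elem_vars by (metis finite_imageI)
  from ExElem[of "f(x := z)" g] obtain \<psi> where wf: "wf_wmso \<sigma> \<psi> = wf_wmso \<sigma> \<phi>" and
    \<psi>: "\<And>(A :: ('r, 'u) rel_struct) e s. sat A e s \<psi> \<longleftrightarrow> sat A (\<lambda>i. e ((f(x := z)) i)) (\<lambda>i. s (g i)) \<phi>"
    by blast
  have "sat A (\<lambda>i. (e(z := u)) ((f(x := z)) i)) (\<lambda>i. s (g i)) \<phi> \<longleftrightarrow>
      sat A ((\<lambda>i. e (f i))(x := u)) (\<lambda>i. s (g i)) \<phi>" for A :: "('r, 'u) rel_struct" and e u s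
    by (rule sat_cong_free_vars) (use z in auto)
  with wf \<psi> show ?case by (intro exI[of _ "wmso.ExElem z \<psi>"]) simp
next
  case (ExSet x \<phi>)
  obtain z where z: "z \<notin> g ` free_set_vars \<phi>"
    using fresh_nat finite_free_set_vars by (metis finite_imageI)
  from ExSet[of f "g(x := z)"] obtain \<psi> where wf: "wf_wmso \<sigma> \<psi> = wf_wmso \<sigma> \<phi>" and
    \<psi>: "\<And>(A :: ('r, 'u) rel_struct) e s. sat A e s \<psi> \<longleftrightarrow> sat A (\<lambda>i. e (f i)) (\<lambda>i. s ((g(x := z)) i)) \<phi>"
    by blast
  have "sat A (\<lambda>i. e (f i)) (\<lambda>i. (s(z := U)) ((g(x := z)) i)) \<phi> \<longleftrightarrow>
      sat A (\<lambda>i. e (f i)) ((\<lambda>i. s (g i))(x := U)) \<phi>" for A :: "('r, 'u) rel_struct" and e U s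
    by (rule sat_cong_free_vars) (use z in auto)
  with wf \<psi> show ?case by (intro exI[of _ "wmso.ExSet z \<psi>"]) simp
qed

lemma valuation_rename: "valuation t e s \<Longrightarrow> valuation t (\<lambda>i. e (f i)) (\<lambda>i. s (g i))"
  by (auto simp: valuation_def)

lemma valuation_upd_elem: "valuation t e s \<Longrightarrow> u \<in> dom t \<Longrightarrow> valuation t (e(x := u)) s"
  by (simp add: valuation_def)

lemma valuation_upd_set:
  "valuation t e s \<Longrightarrow> finite U \<Longrightarrow> U \<subseteq> dom t \<Longrightarrow> valuation t e (s(X := U))"
  by (auto simp: valuation_def)

lemma definable_rename:
  assumes "definable \<Sigma> P"
  shows "definable \<Sigma> (\<lambda>t e s. P t (\<lambda>i. e (f i)) (\<lambda>i. s (g i)))"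
proof -
  from assms obtain \<phi> where \<phi>: "wf_wmso (tree_signature \<Sigma>) \<phi>"
    "\<And>t e s. is_tree \<Sigma> t \<Longrightarrow> valuation t e s \<Longrightarrow> sat (tree_struct t) e s \<phi> \<longleftrightarrow> P t e s"
    unfolding definable_def by blast
  obtain \<psi> where \<psi>: "wf_wmso (tree_signature \<Sigma>) \<psi> = wf_wmso (tree_signature \<Sigma>) \<phi>"
    "\<And>(A :: ('a tree_sym, bool list) rel_struct) e s. sat A e s \<psi> \<longleftrightarrow> sat A (\<lambda>i. e (f i)) (\<lambda>i. s (g i)) \<phi>"
    using rename_wmso by blast
  show ?thesis
    by (rule definableI[of _ \<psi>]) (simp_all add: \<psi> \<phi> valuation_rename)
qed

text \<open>The bound variable keeps its number here. This suits tests, which take the whole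
  valuation as an opaque argument of which a single entry is overwritten.\<close>

lemma definable_ex_elem_named:
  assumes "definable \<Sigma> P"
  shows "definable \<Sigma> (\<lambda>t e s. \<exists>u\<in>dom t. P t (e(x := u)) s)"
proof -
  from assms obtain \<phi> where \<phi>: "wf_wmso (tree_signature \<Sigma>) \<phi>"
    "\<And>t e s. is_tree \<Sigma> t \<Longrightarrow> valuation t e s \<Longrightarrow> sat (tree_struct t) e s \<phi> \<longleftrightarrow> P t e s"
    unfolding definable_def by blast
  show ?thesis
    by (rule definableI[of _ "ExElem x \<phi>"]) (simp_all add: \<phi> valuation_upd_elem)
qed

lemma definable_ex_set_named:
  assumes "definable \<Sigma> P"
  shows "definable \<Sigma> (\<lambda>t e s. \<exists>U. finite U \<and> U \<subseteq> dom t \<and> P t e (s(X := U)))"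
proof -
  from assms obtain \<phi> where \<phi>: "wf_wmso (tree_signature \<Sigma>) \<phi>"
    "\<And>t e s. is_tree \<Sigma> t \<Longrightarrow> valuation t e s \<Longrightarrow> sat (tree_struct t) e s \<phi> \<longleftrightarrow> P t e s"
    unfolding definable_def by blast
  show ?thesis
    by (rule definableI[of _ "ExSet X \<phi>"]) (auto simp: \<phi> valuation_upd_set)
qed

text \<open>In the next two rules the bound variable becomes number 0 and the others are shifted, so no
  freshness conditions arise.\<close>

lemma definable_ex_elem:
  assumes "definable \<Sigma> (\<lambda>t e s. P t (\<lambda>i. e (Suc i)) s (e 0))"
  shows "definable \<Sigma> (\<lambda>t e s. \<exists>u\<in>dom t. P t e s u)"
proof -
  from assms obtain \<phi> where \<phi>: "wf_wmso (tree_signature \<Sigma>) \<phi>"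
    "\<And>t e s. is_tree \<Sigma> t \<Longrightarrow> valuation t e s \<Longrightarrow>
      sat (tree_struct t) e s \<phi> \<longleftrightarrow> P t (\<lambda>i. e (Suc i)) s (e 0)"
    unfolding definable_def by blast
  obtain z where z: "z \<notin> (\<lambda>i. i - 1) ` free_elem_vars \<phi>"
    using fresh_nat finite_free_elem_vars by (metis finite_imageI)
  let ?f = "\<lambda>i. if i = 0 then z else i - 1"
  obtain \<psi> where \<psi>: "wf_wmso (tree_signature \<Sigma>) \<psi> = wf_wmso (tree_signature \<Sigma>) \<phi>"
    "\<And>(A :: ('a tree_sym, bool list) rel_struct) e s. sat A e s \<psi> \<longleftrightarrow> sat A (\<lambda>i. e (?f i)) s \<phi>"
    using rename_wmso[of "tree_signature \<Sigma>" \<phi> ?f "\<lambda>i. i"] by blast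
  have eq: "sat (tree_struct t) (e(z := u)) s \<psi> \<longleftrightarrow> P t e s u"
    if "is_tree \<Sigma> t" "valuation t e s" "u \<in> dom t" for t e s u
  proof -
    have "sat (tree_struct t) (\<lambda>i. (e(z := u)) (?f i)) s \<phi> \<longleftrightarrow> sat (tree_struct t) (case_nat u e) s \<phi>"
    proof (rule sat_cong_free_vars)
      fix i assume "i \<in> free_elem_vars \<phi>"
      then have "i - 1 \<noteq> z" using z by auto
      then show "(e(z := u)) (?f i) = case_nat u e i" by (cases i) auto
    qed simp
    moreover have "valuation t (case_nat u e) s"
      using that by (auto simp: valuation_def split: nat.split)
    ultimately show ?thesis using \<phi>(2)[OF that(1), of "case_nat u e" s] by (simp add: \<psi>(2))
  qed
  show ?thesis
    by (rule definableI[of _ "ExElem z \<psi>"]) (simp_all add: \<psi>(1) \<phi>(1) eq)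
qed

lemma definable_ex_set:
  assumes "definable \<Sigma> (\<lambda>t e s. P t e (\<lambda>i. s (Suc i)) (s 0))"
  shows "definable \<Sigma> (\<lambda>t e s. \<exists>U. finite U \<and> U \<subseteq> dom t \<and> P t e s U)"
proof -
  from assms obtain \<phi> where \<phi>: "wf_wmso (tree_signature \<Sigma>) \<phi>"
    "\<And>t e s. is_tree \<Sigma> t \<Longrightarrow> valuation t e s \<Longrightarrow>
      sat (tree_struct t) e s \<phi> \<longleftrightarrow> P t e (\<lambda>i. s (Suc i)) (s 0)"
    unfolding definable_def by blast
  obtain z where z: "z \<notin> (\<lambda>i. i - 1) ` free_set_vars \<phi>"
    using fresh_nat finite_free_set_vars by (metis finite_imageI)
  let ?f = "\<lambda>i. if i = 0 then z else i - 1"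
  obtain \<psi> where \<psi>: "wf_wmso (tree_signature \<Sigma>) \<psi> = wf_wmso (tree_signature \<Sigma>) \<phi>"
    "\<And>(A :: ('a tree_sym, bool list) rel_struct) e s. sat A e s \<psi> \<longleftrightarrow> sat A e (\<lambda>i. s (?f i)) \<phi>"
    using rename_wmso[of "tree_signature \<Sigma>" \<phi> "\<lambda>i. i" ?f] by blast
  have eq: "sat (tree_struct t) e (s(z := U)) \<psi> \<longleftrightarrow> P t e s U"
    if "is_tree \<Sigma> t" "valuation t e s" "finite U" "U \<subseteq> dom t" for t e s U
  proof -
    have "sat (tree_struct t) e (\<lambda>i. (s(z := U)) (?f i)) \<phi> \<longleftrightarrow> sat (tree_struct t) e (case_nat U s) \<phi>"
    proof (rule sat_cong_free_vars)
      fix i assume "i \<in> free_set_vars \<phi>"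
      then have "i - 1 \<noteq> z" using z by auto
      then show "(s(z := U)) (?f i) = case_nat U s i" by (cases i) auto
    qed simp
    moreover have "valuation t e (case_nat U s)"
      using that by (auto simp: valuation_def split: nat.split)
    ultimately show ?thesis using \<phi>(2)[OF that(1), of e "case_nat U s"] by (simp add: \<psi>(2))
  qed
  show ?thesis
    by (rule definableI[of _ "ExSet z \<psi>"]) (auto simp: \<psi>(1) \<phi>(1) eq)
qed

section \<open>Connectives, atoms and bounded quantifiers\<close>

lemma definable_not:
  assumes "definable \<Sigma> P"
  shows "definable \<Sigma> (\<lambda>t e s. \<not> P t e s)"
proof -
  from assms obtain \<phi> where \<phi>: "wf_wmso (tree_signature \<Sigma>) \<phi>"
    "\<And>t e s. is_tree \<Sigma> t \<Longrightarrow> valuation t e s \<Longrightarrow> sat (tree_struct t) e s \<phi> \<longleftrightarrow> P t e s"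
    unfolding definable_def by blast
  show ?thesis
    by (rule definableI[of _ "Neg \<phi>"]) (simp_all add: \<phi>)
qed

lemma definable_conj:
  assumes "definable \<Sigma> P" "definable \<Sigma> Q"
  shows "definable \<Sigma> (\<lambda>t e s. P t e s \<and> Q t e s)"
proof -
  from assms(1) obtain \<phi> where \<phi>: "wf_wmso (tree_signature \<Sigma>) \<phi>"
    "\<And>t e s. is_tree \<Sigma> t \<Longrightarrow> valuation t e s \<Longrightarrow> sat (tree_struct t) e s \<phi> \<longleftrightarrow> P t e s"
    unfolding definable_def by blast
  from assms(2) obtain \<psi> where \<psi>: "wf_wmso (tree_signature \<Sigma>) \<psi>"
    "\<And>t e s. is_tree \<Sigma> t \<Longrightarrow> valuation t e s \<Longrightarrow> sat (tree_struct t) e s \<psi> \<longleftrightarrow> Q t e s"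
    unfolding definable_def by blast
  show ?thesis
    by (rule definableI[of _ "Conj \<phi> \<psi>"]) (simp_all add: \<phi> \<psi>)
qed

lemma definable_eq: "definable \<Sigma> (\<lambda>t e s. e x = e y)"
  by (rule definableI[of _ "Eq x y"]) simp_all

lemma definable_mem: "definable \<Sigma> (\<lambda>t e s. e x \<in> s X)"
  by (rule definableI[of _ "Mem x X"]) simp_all

lemma definable_succ: "definable \<Sigma> (\<lambda>t e s. e y = e x @ [i])"
  by (rule definableI[of _ "Rel (Succ i) [x, y]"])
    (auto simp: tree_signature_def tree_struct_def valuation_def, metis domD)

lemma definable_label:
  assumes "a \<in> \<Sigma>"
  shows "definable \<Sigma> (\<lambda>t e s. t (e x) = Some a)"
  by (rule definableI[of _ "Rel (Label a) [x]"])
    (use assms in \<open>auto simp: tree_signature_def tree_struct_def\<close>)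

lemma definable_disj:
  assumes "definable \<Sigma> P" "definable \<Sigma> Q"
  shows "definable \<Sigma> (\<lambda>t e s. P t e s \<or> Q t e s)"
  using definable_not[OF definable_conj[OF assms[THEN definable_not]]] by simp

lemma definable_imp:
  assumes "definable \<Sigma> P" "definable \<Sigma> Q"
  shows "definable \<Sigma> (\<lambda>t e s. P t e s \<longrightarrow> Q t e s)"
  using definable_disj[OF definable_not[OF assms(1)] assms(2)]
  by (rule definable_cong) blast

lemma definable_iff:
  assumes "definable \<Sigma> P" "definable \<Sigma> Q"
  shows "definable \<Sigma> (\<lambda>t e s. P t e s \<longleftrightarrow> Q t e s)"
  using definable_conj[OF definable_imp[OF assms] definable_imp[OF assms(2,1)]]
  by (rule definable_cong) blast

lemma definable_all_elem:
  assumes "definable \<Sigma> (\<lambda>t e s. P t (\<lambda>i. e (Suc i)) s (e 0))"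
  shows "definable \<Sigma> (\<lambda>t e s. \<forall>u\<in>dom t. P t e s u)"
  using definable_not[OF definable_ex_elem[OF definable_not[OF assms]]]
  by (rule definable_cong) blast

lemma definable_all_set:
  assumes "definable \<Sigma> (\<lambda>t e s. P t e (\<lambda>i. s (Suc i)) (s 0))"
  shows "definable \<Sigma> (\<lambda>t e s. \<forall>U. finite U \<longrightarrow> U \<subseteq> dom t \<longrightarrow> P t e s U)"
  using definable_not[OF definable_ex_set[OF definable_not[OF assms]]]
  by (rule definable_cong) blast

lemma definable_const: "definable \<Sigma> (\<lambda>t e s. b)"
  by (cases b; rule definable_cong[OF definable_eq[of _ 0 0]]
      definable_cong[OF definable_not[OF definable_eq[of _ 0 0]]]) auto

lemma definable_ball:
  assumes "finite A" "\<And>a. a \<in> A \<Longrightarrow> definable \<Sigma> (P a)"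
  shows "definable \<Sigma> (\<lambda>t e s. \<forall>a\<in>A. P a t e s)"
  using assms by (induction A) (simp_all add: definable_const definable_conj)

lemma definable_bex:
  assumes "finite A" "\<And>a. a \<in> A \<Longrightarrow> definable \<Sigma> (P a)"
  shows "definable \<Sigma> (\<lambda>t e s. \<exists>a\<in>A. P a t e s)"
  using assms by (induction A) (simp_all add: definable_const definable_disj)

lemmas definable_intros =
  definable_ex_elem definable_ex_set definable_all_elem definable_all_set
  definable_not definable_conj definable_disj definable_imp definable_iff
  definable_eq definable_mem definable_succ

text \<open>Quantifies a whole block of set variables at once, such as the entries of a tuple whose
  length is the arity of a relation symbol.\<close>

lemma definable_ex_sets_named:
  assumes "finite V" "definable \<Sigma> P"
  shows "definable \<Sigma> (\<lambda>t e s. \<exists>s'. valuation t e s' \<and> (\<forall>i. i \<notin> V \<longrightarrow> s' i = s i) \<and> P t e s')"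
  using assms(1)
proof (induction V)
  case empty
  from assms(2) show ?case
    by (rule definable_cong) (metis ext empty_iff)
next
  case (insert v V)
  from definable_ex_set_named[OF insert.IH, of v] show ?case
  proof (rule definable_cong, intro iffI)
    fix t :: "'a tree" and e s
    assume *: "is_tree \<Sigma> t" "valuation t e s"
    { assume "\<exists>s'. valuation t e s' \<and> (\<forall>i. i \<notin> insert v V \<longrightarrow> s' i = s i) \<and> P t e s'"
      then obtain s' where s': "valuation t e s'" "\<forall>i. i \<notin> insert v V \<longrightarrow> s' i = s i" "P t e s'" by blast
      moreover have "finite (s' v)" "s' v \<subseteq> dom t" using s'(1) by (simp_all add: valuation_def)
      ultimately show "\<exists>U. finite U \<and> U \<subseteq> dom t \<and>
          (\<exists>s'. valuation t e s' \<and> (\<forall>i. i \<notin> V \<longrightarrow> s' i = (s(v := U)) i) \<and> P t e s')"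
        by (intro exI[of _ "s' v"] conjI exI[of _ s']) auto }
    { assume "\<exists>U. finite U \<and> U \<subseteq> dom t \<and>
          (\<exists>s'. valuation t e s' \<and> (\<forall>i. i \<notin> V \<longrightarrow> s' i = (s(v := U)) i) \<and> P t e s')"
      then show "\<exists>s'. valuation t e s' \<and> (\<forall>i. i \<notin> insert v V \<longrightarrow> s' i = s i) \<and> P t e s'" by auto }
  qed
qed

lemma definable_sat:
  assumes "wf_wmso (tree_signature \<Sigma>) \<phi>"
  shows "definable \<Sigma> (\<lambda>t e s. sat (tree_struct t) e s \<phi>)"
  using assms by (rule definableI) simp

lemma holds_eq_sat:
  assumes "set_formula \<sigma> n \<phi>" "length Us = n" "\<And>i. i < n \<Longrightarrow> s i = Us ! i"
  shows "holds A Us \<phi> \<longleftrightarrow> sat A e s \<phi>"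
  unfolding holds_def
  by (rule sat_cong_free_vars) (use assms in \<open>auto simp: set_formula_def\<close>)

lemma definable_holds:
  assumes "set_formula (tree_signature \<Sigma>) (length xs) \<phi>"
  shows "definable \<Sigma> (\<lambda>t e s. holds (tree_struct t) (map s xs) \<phi>)"
proof (rule definable_cong)
  show "definable \<Sigma> (\<lambda>t e s. sat (tree_struct t) (\<lambda>i. e i) (\<lambda>i. s (xs ! i)) \<phi>)"
    using assms by (intro definable_rename[OF definable_sat]) (simp add: set_formula_def)
  show "holds (tree_struct t) (map s xs) \<phi> \<longleftrightarrow> sat (tree_struct t) (\<lambda>i. e i) (\<lambda>i. s (xs ! i)) \<phi>"
    for t :: "'a tree" and e s
    using assms by (rule holds_eq_sat) auto
qed


text \<open>A formula witnessing \<open>definable\<close> may contain stray free variables, which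
  \<open>set_formula\<close> forbids. Binding them existentially is harmless on a nonempty tree when
  the defined property does not depend on their values.\<close>

lemma close_vars:
  fixes \<phi> :: "'a tree_sym wmso"
  assumes "finite F" "finite G"
  shows "\<exists>\<psi>. wf_wmso \<sigma> \<psi> = wf_wmso \<sigma> \<phi> \<and> free_elem_vars \<psi> = free_elem_vars \<phi> - F \<and>
     free_set_vars \<psi> = free_set_vars \<phi> - G \<and>
     (\<forall>(A :: ('a tree_sym, bool list) rel_struct) e s. sat A e s \<psi> \<longleftrightarrow>
       (\<exists>e' s'. (\<forall>i. if i \<in> F then e' i \<in> universe A else e' i = e i) \<and>
          (\<forall>i. if i \<in> G then finite (s' i) \<and> s' i \<subseteq> universe A else s' i = s i) \<and> sat A e' s' \<phi>))"
  using assms(1)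
proof (induction F)
  case empty
  from assms(2) show ?case
  proof (induction G)
    case empty
    show ?case by (rule exI[of _ \<phi>]) (auto simp: fun_eq_iff[symmetric])
  next
    case (insert X G)
    then obtain \<psi> where \<psi>: "wf_wmso \<sigma> \<psi> = wf_wmso \<sigma> \<phi>" "free_elem_vars \<psi> = free_elem_vars \<phi> - {}"
     "free_set_vars \<psi> = free_set_vars \<phi> - G"
     "\<And>(A :: ('a tree_sym, bool list) rel_struct) e s. sat A e s \<psi> \<longleftrightarrow>
       (\<exists>e' s'. (\<forall>i. if i \<in> {} then e' i \<in> universe A else e' i = e i) \<and>
          (\<forall>i. if i \<in> G then finite (s' i) \<and> s' i \<subseteq> universe A else s' i = s i) \<and> sat A e' s' \<phi>)"
      by blast
    have "sat A e s (ExSet X \<psi>) \<longleftrightarrow> (\<exists>e' s'. (\<forall>i. if i \<in> {} then e' i \<in> universe A else e' i = e i) \<and>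
        (\<forall>i. if i \<in> insert X G then finite (s' i) \<and> s' i \<subseteq> universe A else s' i = s i) \<and> sat A e' s' \<phi>)"
      (is "?L \<longleftrightarrow> ?R") for A :: "('a tree_sym, bool list) rel_struct" and e s
    proof
      assume ?L
      then obtain U e' s' where *: "finite U" "U \<subseteq> universe A" "\<forall>i. if i \<in> {} then e' i \<in> universe A else e' i = e i"
        "\<forall>i. if i \<in> G then finite (s' i) \<and> s' i \<subseteq> universe A else s' i = (s(X := U)) i" "sat A e' s' \<phi>"
        by (auto simp: \<psi>(4))
      have "if i \<in> insert X G then finite (s' i) \<and> s' i \<subseteq> universe A else s' i = s i" for i
        using *(1,2) spec[OF *(4), of i] insert.hyps by (cases "i = X") auto
      with *(3,5) show ?R by blast
    next
      assume ?R
      then obtain e' s' where *: "\<forall>i. if i \<in> {} then e' i \<in> universe A else e' i = e i"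
        "\<forall>i. if i \<in> insert X G then finite (s' i) \<and> s' i \<subseteq> universe A else s' i = s i" "sat A e' s' \<phi>"
        by blast
      from *(2) have "finite (s' X)" "s' X \<subseteq> universe A" by (metis insertI1)+
      moreover have "sat A e (s(X := s' X)) \<psi>"
        unfolding \<psi>(4) by (rule exI[of _ e'], rule exI[of _ s']) (use * in auto)
      ultimately show ?L by auto
    qed
    then show ?case using \<psi>(1-3) by (intro exI[of _ "ExSet X \<psi>"] conjI) auto
  qed
next
  case (insert x F)
  then obtain \<psi> where \<psi>: "wf_wmso \<sigma> \<psi> = wf_wmso \<sigma> \<phi>" "free_elem_vars \<psi> = free_elem_vars \<phi> - F"
     "free_set_vars \<psi> = free_set_vars \<phi> - G"
     "\<And>(A :: ('a tree_sym, bool list) rel_struct) e s. sat A e s \<psi> \<longleftrightarrow>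
       (\<exists>e' s'. (\<forall>i. if i \<in> F then e' i \<in> universe A else e' i = e i) \<and>
          (\<forall>i. if i \<in> G then finite (s' i) \<and> s' i \<subseteq> universe A else s' i = s i) \<and> sat A e' s' \<phi>)"
    by blast
  have "sat A e s (ExElem x \<psi>) \<longleftrightarrow> (\<exists>e' s'. (\<forall>i. if i \<in> insert x F then e' i \<in> universe A else e' i = e i) \<and>
      (\<forall>i. if i \<in> G then finite (s' i) \<and> s' i \<subseteq> universe A else s' i = s i) \<and> sat A e' s' \<phi>)"
    (is "?L \<longleftrightarrow> ?R") for A :: "('a tree_sym, bool list) rel_struct" and e s
  proof
    assume ?L
    then obtain u e' s' where *: "u \<in> universe A" "\<forall>i. if i \<in> F then e' i \<in> universe A else e' i = (e(x := u)) i"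
      "\<forall>i. if i \<in> G then finite (s' i) \<and> s' i \<subseteq> universe A else s' i = s i" "sat A e' s' \<phi>"
      by (auto simp: \<psi>(4))
    have "if i \<in> insert x F then e' i \<in> universe A else e' i = e i" for i
      using *(1) spec[OF *(2), of i] insert.hyps by (cases "i = x") auto
    with *(3,4) show ?R by blast
  next
    assume ?R
    then obtain e' s' where *: "\<forall>i. if i \<in> insert x F then e' i \<in> universe A else e' i = e i"
      "\<forall>i. if i \<in> G then finite (s' i) \<and> s' i \<subseteq> universe A else s' i = s i" "sat A e' s' \<phi>"
      by blast
    from *(1) have "e' x \<in> universe A" by (metis insertI1)
    moreover have "sat A (e(x := e' x)) s \<psi>"
      unfolding \<psi>(4) by (rule exI[of _ e'], rule exI[of _ s']) (use * in auto)
    ultimately show ?L by auto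
  qed
  then show ?case using \<psi>(1-3) by (intro exI[of _ "ExElem x \<psi>"] conjI) auto
qed

text \<open>\<open>definable\<close> says nothing about the empty tree, which has no valuations of the element
  variables; there \<open>Us\<close> has a single possible value, and the closed formula settles this case
  separately.\<close>

lemma definable_set_formula:
  assumes "definable \<Sigma> (\<lambda>t e s. P t (map s [0..<n]))"
  obtains \<psi> where "set_formula (tree_signature \<Sigma>) n \<psi>"
    "\<And>t Us. is_tree \<Sigma> t \<Longrightarrow> length Us = n \<Longrightarrow> (\<And>U. U \<in> set Us \<Longrightarrow> finite U \<and> U \<subseteq> dom t) \<Longrightarrow>
       holds (tree_struct t) Us \<psi> \<longleftrightarrow> P t Us"
proof -
  from assms obtain \<phi> where \<phi>: "wf_wmso (tree_signature \<Sigma>) \<phi>"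
    "\<And>t e s. is_tree \<Sigma> t \<Longrightarrow> valuation t e s \<Longrightarrow> sat (tree_struct t) e s \<phi> \<longleftrightarrow> P t (map s [0..<n])"
    unfolding definable_def by blast
  let ?F = "free_elem_vars \<phi>" and ?G = "free_set_vars \<phi> - {..<n}"
  obtain \<psi> where wf: "wf_wmso (tree_signature \<Sigma>) \<psi> = wf_wmso (tree_signature \<Sigma>) \<phi>"
    and fv: "free_elem_vars \<psi> = {}" "free_set_vars \<psi> \<subseteq> {..<n}"
    and \<psi>: "\<And>(A :: ('a tree_sym, bool list) rel_struct) e s. sat A e s \<psi> \<longleftrightarrow>
       (\<exists>e' s'. (\<forall>i. if i \<in> ?F then e' i \<in> universe A else e' i = e i) \<and>
          (\<forall>i. if i \<in> ?G then finite (s' i) \<and> s' i \<subseteq> universe A else s' i = s i) \<and> sat A e' s' \<phi>)"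
    using close_vars[of ?F ?G "tree_signature \<Sigma>" \<phi>] finite_free_elem_vars[of \<phi>] finite_free_set_vars[of \<phi>]
    by auto
  let ?N = "ExElem 0 (Eq 0 0) :: 'a tree_sym wmso"
  define \<chi> where "\<chi> = (if P Map.empty (replicate n {}) then Neg (Conj ?N (Neg \<psi>)) else Conj ?N \<psi>)"
  have sf: "set_formula (tree_signature \<Sigma>) n \<psi>" "set_formula (tree_signature \<Sigma>) n \<chi>"
    using wf fv \<phi>(1) by (auto simp: set_formula_def \<chi>_def)
  have "holds (tree_struct t) Us \<chi> \<longleftrightarrow> P t Us"
    if t: "is_tree \<Sigma> t" and len: "length Us = n" and Us: "\<And>U. U \<in> set Us \<Longrightarrow> finite U \<and> U \<subseteq> dom t"
    for t :: "'a tree" and Us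
  proof (cases "dom t = {}")
    case True
    then have "t = Map.empty" by auto
    moreover have "Us = replicate n {}"
      using len Us True by (intro replicate_eqI) auto
    ultimately show ?thesis by (auto simp: \<chi>_def holds_def)
  next
    case False
    then obtain r where r: "r \<in> dom t" by blast
    define s where "s = (\<lambda>i. if i < n then Us ! i else {})"
    have val: "valuation t (\<lambda>_. r) s" using r Us len by (auto simp: valuation_def s_def)
    have s: "map s [0..<n] = Us" using len by (auto simp: s_def intro: nth_equalityI)
    have "holds (tree_struct t) Us \<chi> \<longleftrightarrow> holds (tree_struct t) Us \<psi>"
      using r by (auto simp: \<chi>_def holds_def)
    also have "\<dots> \<longleftrightarrow> sat (tree_struct t) (\<lambda>_. r) s \<psi>"
      using sf(1) len by (rule holds_eq_sat) (simp add: s_def)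
    also have "\<dots> \<longleftrightarrow> P t Us"
    proof
      assume "sat (tree_struct t) (\<lambda>_. r) s \<psi>"
      then obtain e' s' where *: "\<forall>i. if i \<in> ?F then e' i \<in> dom t else e' i = r"
        "\<forall>i. if i \<in> ?G then finite (s' i) \<and> s' i \<subseteq> dom t else s' i = s i" "sat (tree_struct t) e' s' \<phi>"
        unfolding \<psi> universe_tree_struct by blast
      \<comment> \<open>Whatever values the added quantifiers picked, they form a valuation with the
        same arguments \<open>Us\<close>, and on valuations \<open>\<phi>\<close> expresses a
        property of the arguments alone.\<close>
      have "valuation t e' s'"
        unfolding valuation_def using *(1,2) r val[unfolded valuation_def] by metis
      moreover have "map s' [0..<n] = Us"
        unfolding s[symmetric] using *(2) by auto
      ultimately show "P t Us" using \<phi>(2)[OF t] *(3) by metis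
    next
      assume "P t Us"
      then have "sat (tree_struct t) (\<lambda>_. r) s \<phi>" using \<phi>(2)[OF t val] s by simp
      then show "sat (tree_struct t) (\<lambda>_. r) s \<psi>"
        unfolding \<psi> by (intro exI[of _ "\<lambda>_. r"] exI[of _ s])
          (use r val in \<open>auto simp: valuation_def\<close>)
    qed
    finally show ?thesis .
  qed
  with sf(2) show thesis by (rule that)
qed

section \<open>Composition at a subtree\<close>

definition subtree :: "bool list set \<Rightarrow> bool list \<Rightarrow> bool list set" where
  "subtree T u = {v \<in> T. prefix u v}"

lemma in_subtree [simp]: "v \<in> subtree T u \<longleftrightarrow> v \<in> T \<and> prefix u v"
  by (simp add: subtree_def)

lemma is_tree_prefix: "is_tree \<Sigma> t \<Longrightarrow> v \<in> dom t \<Longrightarrow> prefix u v \<Longrightarrow> u \<in> dom t"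
  unfolding is_tree_def by blast

lemma parent_closed_prefix:
  assumes "prefix u v" "v \<in> Z" "v \<in> T" "\<And>x y. y \<in> T \<Longrightarrow> prefix x y \<Longrightarrow> x \<in> T"
    and "\<forall>x\<in>T. \<forall>y\<in>T. y \<in> Z \<longrightarrow> y = x @ [False] \<or> y = x @ [True] \<longrightarrow> x \<in> Z"
  shows "u \<in> Z"
  using assms(1-3)
proof (induction v rule: rev_induct)
  case (snoc b v)
  show ?case
  proof (cases "u = v @ [b]")
    case False
    then have "prefix u v" using snoc.prems(1) by (simp add: prefix_snoc)
    moreover have "v \<in> T" using snoc.prems(3) assms(4) by (metis prefixI)
    moreover have "v \<in> Z" using assms(5) snoc.prems(2,3) \<open>v \<in> T\<close> by (cases b) blast+
    ultimately show ?thesis using snoc.IH by blast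
  qed (use snoc.prems in simp)
qed simp

text \<open>The ancestor relation is the reflexive transitive closure of the successor relations,
  hence expressible through parent-closed sets. Finite sets suffice because the least parent-closed
  set containing a node is its set of prefixes.\<close>

lemma definable_prefix: "definable \<Sigma> (\<lambda>t e s. prefix (e i) (e j))"
proof (rule definable_cong)
  show "definable \<Sigma> (\<lambda>t e s. \<forall>Z. finite Z \<longrightarrow> Z \<subseteq> dom t \<longrightarrow> e j \<in> Z \<longrightarrow>
      (\<forall>x\<in>dom t. \<forall>y\<in>dom t. y \<in> Z \<longrightarrow> y = x @ [False] \<or> y = x @ [True] \<longrightarrow> x \<in> Z) \<longrightarrow> e i \<in> Z)"
    by (intro definable_intros)
next
  fix t :: "'a tree" and e s
  assume t: "is_tree \<Sigma> t" and val: "valuation t e s"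
  show "prefix (e i) (e j) \<longleftrightarrow> (\<forall>Z. finite Z \<longrightarrow> Z \<subseteq> dom t \<longrightarrow> e j \<in> Z \<longrightarrow>
      (\<forall>x\<in>dom t. \<forall>y\<in>dom t. y \<in> Z \<longrightarrow> y = x @ [False] \<or> y = x @ [True] \<longrightarrow> x \<in> Z) \<longrightarrow> e i \<in> Z)"
  proof (intro iffI allI impI)
    fix Z
    assume "prefix (e i) (e j)" "e j \<in> Z" "Z \<subseteq> dom t"
      "\<forall>x\<in>dom t. \<forall>y\<in>dom t. y \<in> Z \<longrightarrow> y = x @ [False] \<or> y = x @ [True] \<longrightarrow> x \<in> Z"
    then show "e i \<in> Z"
      using parent_closed_prefix[of "e i" "e j" Z "dom t"] is_tree_prefix[OF t] by blast
  next
    assume *: "\<forall>Z. finite Z \<longrightarrow> Z \<subseteq> dom t \<longrightarrow> e j \<in> Z \<longrightarrow>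
      (\<forall>x\<in>dom t. \<forall>y\<in>dom t. y \<in> Z \<longrightarrow> y = x @ [False] \<or> y = x @ [True] \<longrightarrow> x \<in> Z) \<longrightarrow> e i \<in> Z"
    have "e j \<in> dom t" using val by (simp add: valuation_def)
    then have "set (prefixes (e j)) \<subseteq> dom t"
      using is_tree_prefix[OF t] unfolding in_set_prefixes subset_iff by blast
    moreover have "finite (set (prefixes (e j)))" "e j \<in> set (prefixes (e j))"
      "\<forall>x\<in>dom t. \<forall>y\<in>dom t. y \<in> set (prefixes (e j)) \<longrightarrow> y = x @ [False] \<or> y = x @ [True] \<longrightarrow>
        x \<in> set (prefixes (e j))"
      by (auto intro: append_prefixD)
    ultimately have "e i \<in> set (prefixes (e j))" using * by blast
    then show "prefix (e i) (e j)" by simp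
  qed
qed

text \<open>A test sees the whole tree, not just the subtree: the valuations to be compared live on
  the same tree, so only their values are restricted to the subtree and no formula has to be
  relativized.\<close>

type_synonym 'a test =
  "'a tree \<Rightarrow> bool list \<Rightarrow> (nat \<Rightarrow> bool list) \<Rightarrow> (nat \<Rightarrow> bool list set) \<Rightarrow> bool"

definition definable_test :: "'a set \<Rightarrow> 'a test \<Rightarrow> bool" where
  "definable_test \<Sigma> \<theta> \<longleftrightarrow> definable \<Sigma> (\<lambda>t e s. \<theta> t (e 0) (\<lambda>i. e (Suc i)) s)"

text \<open>A test must not depend on values outside the subtree, yet every element variable needs
  some node; the root \<open>u\<close> is the default.\<close>

definition inner :: "'a tree \<Rightarrow> bool list \<Rightarrow> (nat \<Rightarrow> bool list) \<Rightarrow> nat \<Rightarrow> bool list" where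
  "inner t u e = (\<lambda>x. if e x \<in> subtree (dom t) u then e x else u)"

text \<open>The set \<open>P\<close> is fixed beforehand because a test cannot distinguish a
  variable whose value is \<open>u\<close> from one that \<open>inner\<close> has sent
  there.\<close>

definition same_outside ::
  "'a tree \<Rightarrow> bool list \<Rightarrow> nat set \<Rightarrow> (nat \<Rightarrow> bool list) \<Rightarrow> (nat \<Rightarrow> bool list set) \<Rightarrow>
     (nat \<Rightarrow> bool list) \<Rightarrow> (nat \<Rightarrow> bool list set) \<Rightarrow> bool" where
  "same_outside t u P e s e' s' \<longleftrightarrow> u \<in> dom t \<and> valuation t e s \<and> valuation t e' s' \<and>
     (\<forall>x. e x \<in> subtree (dom t) u \<longleftrightarrow> x \<in> P) \<and> (\<forall>x. e' x \<in> subtree (dom t) u \<longleftrightarrow> x \<in> P) \<and>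
     (\<forall>x. x \<notin> P \<longrightarrow> e x = e' x) \<and> (\<forall>X. s X - subtree (dom t) u = s' X - subtree (dom t) u)"

definition same_inside ::
  "'a test set \<Rightarrow> 'a tree \<Rightarrow> bool list \<Rightarrow> (nat \<Rightarrow> bool list) \<Rightarrow> (nat \<Rightarrow> bool list set) \<Rightarrow>
     (nat \<Rightarrow> bool list) \<Rightarrow> (nat \<Rightarrow> bool list set) \<Rightarrow> bool" where
  "same_inside \<Theta> t u e s e' s' \<longleftrightarrow> (\<forall>\<theta>\<in>\<Theta>.
     \<theta> t u (inner t u e) (\<lambda>X. s X \<inter> subtree (dom t) u) \<longleftrightarrow>
     \<theta> t u (inner t u e') (\<lambda>X. s' X \<inter> subtree (dom t) u))"

definition determines :: "'a set \<Rightarrow> nat set \<Rightarrow> 'a test set \<Rightarrow> 'a tree_sym wmso \<Rightarrow> bool" where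
  "determines \<Sigma> P \<Theta> \<phi> \<longleftrightarrow> (\<forall>t u e s e' s'. is_tree \<Sigma> t \<longrightarrow> same_outside t u P e s e' s' \<longrightarrow>
     same_inside \<Theta> t u e s e' s' \<longrightarrow> sat (tree_struct t) e s \<phi> \<longrightarrow> sat (tree_struct t) e' s' \<phi>)"

lemma same_outside_sym: "same_outside t u P e s e' s' \<Longrightarrow> same_outside t u P e' s' e s"
  unfolding same_outside_def by auto

lemma same_inside_sym: "same_inside \<Theta> t u e s e' s' \<Longrightarrow> same_inside \<Theta> t u e' s' e s"
  unfolding same_inside_def by auto

lemma same_inside_mono: "same_inside \<Theta> t u e s e' s' \<Longrightarrow> \<Theta>' \<subseteq> \<Theta> \<Longrightarrow> same_inside \<Theta>' t u e s e' s'"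
  unfolding same_inside_def by blast

lemma determinesI:
  assumes "\<And>t u e s e' s'. is_tree \<Sigma> t \<Longrightarrow> same_outside t u P e s e' s' \<Longrightarrow>
     same_inside \<Theta> t u e s e' s' \<Longrightarrow> sat (tree_struct t) e s \<phi> \<Longrightarrow> sat (tree_struct t) e' s' \<phi>"
  shows "determines \<Sigma> P \<Theta> \<phi>"
  using assms unfolding determines_def by blast

lemma determinesD:
  assumes "determines \<Sigma> P \<Theta> \<phi>" "is_tree \<Sigma> t" "same_outside t u P e s e' s'" "same_inside \<Theta> t u e s e' s'"
  shows "sat (tree_struct t) e s \<phi> \<longleftrightarrow> sat (tree_struct t) e' s' \<phi>"
  using assms same_outside_sym same_inside_sym unfolding determines_def by meson

text \<open>Types one quantifier level up, as in Hintikka formulas: each new test asks whether an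
  exact pattern \<open>S\<close> over the old tests is realizable, so that a witness on one side can
  be answered by one of the same pattern on the other.\<close>

definition set_types :: "nat \<Rightarrow> 'a test set \<Rightarrow> 'a test set" where
  "set_types X \<Theta> = (\<lambda>S t u e s. \<exists>Z. finite Z \<and> Z \<subseteq> subtree (dom t) u \<and>
     (\<forall>\<theta>\<in>\<Theta>. \<theta> \<in> S \<longleftrightarrow> \<theta> t u e (s(X := Z)))) ` Pow \<Theta>"

definition elem_types :: "nat \<Rightarrow> 'a test set \<Rightarrow> 'a test set" where
  "elem_types x \<Theta> = (\<lambda>S t u e s. \<exists>v\<in>subtree (dom t) u.
     (\<forall>\<theta>\<in>\<Theta>. \<theta> \<in> S \<longleftrightarrow> \<theta> t u (e(x := v)) s)) ` Pow \<Theta>"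

text \<open>For a witness outside the subtree, where \<open>inner\<close> sends the quantified
  variable to \<open>u\<close>.\<close>

definition reset_tests :: "nat \<Rightarrow> 'a test set \<Rightarrow> 'a test set" where
  "reset_tests x \<Theta> = (\<lambda>\<theta> t u e s. \<theta> t u (e(x := u)) s) ` \<Theta>"

lemma definable_set_types:
  assumes "finite \<Theta>" "\<forall>\<theta>\<in>\<Theta>. definable_test \<Sigma> \<theta>" "\<theta> \<in> set_types X \<Theta>"
  shows "definable_test \<Sigma> \<theta>"
proof -
  from assms(3) obtain S where \<theta>: "\<theta> = (\<lambda>t u e s. \<exists>Z. finite Z \<and> Z \<subseteq> subtree (dom t) u \<and>
      (\<forall>\<theta>\<in>\<Theta>. \<theta> \<in> S \<longleftrightarrow> \<theta> t u e (s(X := Z))))"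
    unfolding set_types_def by blast
  let ?P = "\<lambda>t e s. (\<forall>v\<in>dom t. v \<in> s X \<longrightarrow> prefix (e 0) v) \<and>
      (\<forall>\<theta>\<in>\<Theta>. \<theta> \<in> S \<longleftrightarrow> \<theta> t (e 0) (\<lambda>i. e (Suc i)) s)"
  have "definable \<Sigma> ?P"
    using assms(1,2)
    by (intro definable_intros definable_prefix definable_ball definable_const)
      (auto simp: definable_test_def)
  from definable_ex_set_named[OF this, of X] show ?thesis
    unfolding definable_test_def \<theta>
  proof (rule definable_cong)
    fix t :: "'a tree" and e s
    show "(\<exists>Z. finite Z \<and> Z \<subseteq> subtree (dom t) (e 0) \<and>
         (\<forall>\<theta>\<in>\<Theta>. \<theta> \<in> S \<longleftrightarrow> \<theta> t (e 0) (\<lambda>i. e (Suc i)) (s(X := Z)))) \<longleftrightarrow>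
       (\<exists>U. finite U \<and> U \<subseteq> dom t \<and> ?P t e (s(X := U)))"
      by (intro ex_cong1) (auto simp: subset_iff)
  qed
qed

lemma definable_elem_types:
  assumes "finite \<Theta>" "\<forall>\<theta>\<in>\<Theta>. definable_test \<Sigma> \<theta>" "\<theta> \<in> elem_types x \<Theta>"
  shows "definable_test \<Sigma> \<theta>"
proof -
  from assms(3) obtain S where \<theta>: "\<theta> = (\<lambda>t u e s. \<exists>v\<in>subtree (dom t) u.
      (\<forall>\<theta>\<in>\<Theta>. \<theta> \<in> S \<longleftrightarrow> \<theta> t u (e(x := v)) s))"
    unfolding elem_types_def by blast
  let ?P = "\<lambda>t e s. prefix (e 0) (e (Suc x)) \<and>
      (\<forall>\<theta>\<in>\<Theta>. \<theta> \<in> S \<longleftrightarrow> \<theta> t (e 0) (\<lambda>i. e (Suc i)) s)"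
  have "definable \<Sigma> ?P"
    using assms(1,2)
    by (intro definable_intros definable_prefix definable_ball definable_const)
      (auto simp: definable_test_def)
  from definable_ex_elem_named[OF this, of "Suc x"] show ?thesis
    unfolding definable_test_def \<theta>
  proof (rule definable_cong)
    fix t :: "'a tree" and e s
    have "(\<lambda>i. (e(Suc x := v)) (Suc i)) = (\<lambda>i. e (Suc i))(x := v)" "(e(Suc x := v)) 0 = e 0"
      for v :: "bool list" by auto
    then show "(\<exists>v\<in>subtree (dom t) (e 0).
         (\<forall>\<theta>\<in>\<Theta>. \<theta> \<in> S \<longleftrightarrow> \<theta> t (e 0) ((\<lambda>i. e (Suc i))(x := v)) s)) \<longleftrightarrow>
       (\<exists>v\<in>dom t. ?P t (e(Suc x := v)) s)"
      by (simp only: Bex_def in_subtree conj_assoc fun_upd_same)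
  qed
qed

lemma definable_reset_tests:
  assumes "\<forall>\<theta>\<in>\<Theta>. definable_test \<Sigma> \<theta>" "\<theta> \<in> reset_tests x \<Theta>"
  shows "definable_test \<Sigma> \<theta>"
proof -
  from assms obtain \<theta>' where \<theta>: "\<theta> = (\<lambda>t u e s. \<theta>' t u (e(x := u)) s)" and "definable_test \<Sigma> \<theta>'"
    unfolding reset_tests_def by blast
  from definable_rename[OF this(2)[unfolded definable_test_def], of "\<lambda>i. if i = Suc x then 0 else i" "\<lambda>i. i"]
  show ?thesis
    unfolding definable_test_def \<theta>
    by (rule definable_cong) (auto simp: fun_upd_def if_distrib cong: if_cong)
qed

lemma inner_upd_inside:
  "v \<in> subtree (dom t) u \<Longrightarrow> inner t u (e(x := v)) = (inner t u e)(x := v)"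
  by (rule ext) (auto simp: inner_def)

lemma inner_upd_outside:
  "v \<notin> subtree (dom t) u \<Longrightarrow> inner t u (e(x := v)) = (inner t u e)(x := u)"
  by (rule ext) (auto simp: inner_def)


lemma same_outside_upd_set:
  assumes "same_outside t u P e s e' s'" "finite U" "U \<subseteq> dom t" "finite Z" "Z \<subseteq> subtree (dom t) u"
  shows "same_outside t u P e (s(X := U)) e' (s'(X := (U - subtree (dom t) u) \<union> Z))"
proof -
  let ?U = "(U - subtree (dom t) u) \<union> Z"
  have "finite ?U" "?U \<subseteq> dom t" using assms(2-5) unfolding subset_iff in_subtree by blast+
  then have "valuation t e (s(X := U))" "valuation t e' (s'(X := ?U))"
    using assms(1-3) unfolding same_outside_def by (blast intro: valuation_upd_set)+
  moreover have "(s(X := U)) i - subtree (dom t) u = (s'(X := ?U)) i - subtree (dom t) u" for i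
  proof (cases "i = X")
    case True
    then show ?thesis using assms(5) by auto
  next
    case False
    then show ?thesis using assms(1) unfolding same_outside_def by simp
  qed
  ultimately show ?thesis using assms(1) unfolding same_outside_def by blast
qed

text \<open>A witness \<open>U\<close> is split at the boundary of the subtree. Its outer part is
  copied; its inner part is answered by a set \<open>Z\<close> with the same pattern of tests, which
  exists because realizability of that pattern is itself a test.\<close>

lemma determines_ex_set:
  assumes "determines \<Sigma> P \<Theta> \<phi>"
  shows "determines \<Sigma> P (set_types X \<Theta>) (ExSet X \<phi>)"
proof (rule determinesI)
  fix t u e s e' s'
  assume t: "is_tree \<Sigma> t" and out: "same_outside t u P e s e' s'"
    and ins: "same_inside (set_types X \<Theta>) t u e s e' s'" and "sat (tree_struct t) e s (ExSet X \<phi>)"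
  let ?S = "subtree (dom t) u"
  let ?r = "\<lambda>s X. s X \<inter> ?S"
  from \<open>sat _ _ _ _\<close> obtain U where U: "finite U" "U \<subseteq> dom t" "sat (tree_struct t) e (s(X := U)) \<phi>"
    by auto
  have rU: "?r (s(X := U)) = (?r s)(X := U \<inter> ?S)" by (rule ext) auto
  define S where "S = {\<theta> \<in> \<Theta>. \<theta> t u (inner t u e) ((?r s)(X := U \<inter> ?S))}"
  define \<psi> where "\<psi> = (\<lambda>t u e s. \<exists>Z. finite Z \<and> Z \<subseteq> subtree (dom t) u \<and>
      (\<forall>\<theta>\<in>\<Theta>. \<theta> \<in> S \<longleftrightarrow> \<theta> t u e (s(X := Z))))"
  have "\<psi> \<in> set_types X \<Theta>" unfolding set_types_def \<psi>_def S_def by blast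
  moreover have "\<psi> t u (inner t u e) (?r s)"
    unfolding \<psi>_def S_def using U by (intro exI[of _ "U \<inter> ?S"]) auto
  ultimately have "\<psi> t u (inner t u e') (?r s')" using ins unfolding same_inside_def by blast
  then obtain Z where Z: "finite Z" "Z \<subseteq> ?S"
    "\<forall>\<theta>\<in>\<Theta>. \<theta> \<in> S \<longleftrightarrow> \<theta> t u (inner t u e') ((?r s')(X := Z))"
    unfolding \<psi>_def by blast
  have rZ: "?r (s'(X := (U - ?S) \<union> Z)) = (?r s')(X := Z)" using Z(2) by (intro ext) auto
  have "same_inside \<Theta> t u e (s(X := U)) e' (s'(X := (U - ?S) \<union> Z))"
    unfolding same_inside_def rU rZ using Z(3) unfolding S_def by blast
  from determinesD[OF assms t same_outside_upd_set[OF out U(1,2) Z(1,2)] this] U(3)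
  have "sat (tree_struct t) e' (s'(X := (U - ?S) \<union> Z)) \<phi>" by blast
  moreover have "finite ((U - ?S) \<union> Z)" "(U - ?S) \<union> Z \<subseteq> dom t" using U Z by auto
  ultimately show "sat (tree_struct t) e' s' (ExSet X \<phi>)"
    unfolding sat.simps universe_tree_struct by blast
qed

lemma same_outside_upd_inside:
  assumes "same_outside t u P e s e' s'" "v \<in> subtree (dom t) u" "v' \<in> subtree (dom t) u"
  shows "same_outside t u (insert x P) (e(x := v)) s (e'(x := v')) s'"
proof -
  have "valuation t (e(x := v)) s" "valuation t (e'(x := v')) s'"
    using assms unfolding same_outside_def in_subtree by (blast intro: valuation_upd_elem)+
  then show ?thesis using assms unfolding same_outside_def fun_upd_apply by simp
qed

lemma same_outside_upd_outside:
  assumes "same_outside t u P e s e' s'" "v \<in> dom t" "v \<notin> subtree (dom t) u"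
  shows "same_outside t u (P - {x}) (e(x := v)) s (e'(x := v)) s'"
proof -
  have "valuation t (e(x := v)) s" "valuation t (e'(x := v)) s'"
    using assms unfolding same_outside_def by (blast intro: valuation_upd_elem)+
  then show ?thesis using assms unfolding same_outside_def fun_upd_apply by simp
qed

text \<open>A witness inside the subtree is answered by a node with the same pattern of tests, and a
  witness outside is reused unchanged. The two cases affect \<open>P\<close> differently, so the
  body has to be analysed once for each.\<close>

lemma determines_ex_elem:
  assumes "determines \<Sigma> (insert x P) \<Theta>1 \<phi>" "determines \<Sigma> (P - {x}) \<Theta>2 \<phi>"
  shows "determines \<Sigma> P (elem_types x \<Theta>1 \<union> reset_tests x \<Theta>2) (ExElem x \<phi>)"
proof (rule determinesI)
  fix t u e s e' s'
  assume t: "is_tree \<Sigma> t" and out: "same_outside t u P e s e' s'"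
    and ins: "same_inside (elem_types x \<Theta>1 \<union> reset_tests x \<Theta>2) t u e s e' s'"
    and "sat (tree_struct t) e s (ExElem x \<phi>)"
  let ?S = "subtree (dom t) u"
  let ?r = "\<lambda>s X. s X \<inter> ?S"
  from \<open>sat _ _ _ _\<close> obtain v where v: "v \<in> dom t" "sat (tree_struct t) (e(x := v)) s \<phi>"
    by auto
  show "sat (tree_struct t) e' s' (ExElem x \<phi>)"
  proof (cases "v \<in> ?S")
    case True
    define S where "S = {\<theta> \<in> \<Theta>1. \<theta> t u ((inner t u e)(x := v)) (?r s)}"
    define \<psi> where "\<psi> = (\<lambda>t u e s. \<exists>v\<in>subtree (dom t) u.
        (\<forall>\<theta>\<in>\<Theta>1. \<theta> \<in> S \<longleftrightarrow> \<theta> t u (e(x := v)) s))"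
    have "\<psi> \<in> elem_types x \<Theta>1" unfolding elem_types_def \<psi>_def S_def by blast
    moreover have "\<psi> t u (inner t u e) (?r s)"
      unfolding \<psi>_def S_def using True by blast
    ultimately have "\<psi> t u (inner t u e') (?r s')" using ins unfolding same_inside_def by blast
    then obtain v' where v': "v' \<in> ?S"
      "\<forall>\<theta>\<in>\<Theta>1. \<theta> \<in> S \<longleftrightarrow> \<theta> t u ((inner t u e')(x := v')) (?r s')"
      unfolding \<psi>_def by blast
    have "same_inside \<Theta>1 t u (e(x := v)) s (e'(x := v')) s'"
      unfolding same_inside_def inner_upd_inside[OF True] inner_upd_inside[OF v'(1)]
      using v'(2) unfolding S_def by blast
    from determinesD[OF assms(1) t same_outside_upd_inside[OF out True v'(1)] this] v(2) v'(1)
    show ?thesis unfolding sat.simps universe_tree_struct in_subtree by blast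
  next
    case False
    have "same_inside \<Theta>2 t u (e(x := v)) s (e'(x := v)) s'"
      using same_inside_mono[OF ins Un_upper2]
      by (simp only: same_inside_def reset_tests_def ball_simps inner_upd_outside[OF False])
    from determinesD[OF assms(2) t same_outside_upd_outside[OF out v(1) False] this] v
    show ?thesis unfolding sat.simps universe_tree_struct by blast
  qed
qed

text \<open>Composition in the style of Feferman and Vaught: finitely many tests on the part of a valuation
  inside the subtree at \<open>u\<close> suffice to evaluate \<open>\<phi>\<close> once the part outside is fixed.\<close>

lemma composition:
  assumes "wf_wmso (tree_signature \<Sigma>) \<phi>"
  shows "\<exists>\<Theta>. finite \<Theta> \<and> (\<forall>\<theta>\<in>\<Theta>. definable_test \<Sigma> \<theta>) \<and> determines \<Sigma> P \<Theta> \<phi>"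
  using assms
proof (induction \<phi> arbitrary: P)
  case (Rel R xs)
  show ?case
  proof (cases R)
    case (Succ i)
    with Rel have "length xs = 2" by (auto simp: tree_signature_def)
    then obtain x y where xs: "xs = [x, y]" by (auto simp: length_Suc_conv numeral_2_eq_2)
    \<comment> \<open>The second test handles the only edge that enters the subtree: its source lies
      outside and its target is the root \<open>u\<close>.\<close>
    let ?\<Theta> = "{\<lambda>t u e s. e y = e x @ [i], \<lambda>t u e s. e y = u}"
    have "determines \<Sigma> P ?\<Theta> (Rel R xs)"
    proof (rule determinesI)
      fix t u e s e' s'
      assume t: "is_tree \<Sigma> t" and out: "same_outside t u P e s e' s'"
        and ins: "same_inside ?\<Theta> t u e s e' s'" and "sat (tree_struct t) e s (Rel R xs)"
      then have y: "e y = e x @ [i]" by (auto simp: Succ xs tree_struct_def)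
      have 1: "e y \<in> dom t" "e' y \<in> dom t" "e x \<in> dom t" "e' x \<in> dom t"
        using out by (auto simp: same_outside_def valuation_def)
      have yP: "y \<in> P \<longleftrightarrow> prefix u (e y)" "y \<in> P \<longleftrightarrow> prefix u (e' y)"
        and xP: "x \<in> P \<longleftrightarrow> prefix u (e x)" "x \<in> P \<longleftrightarrow> prefix u (e' x)"
        using out 1 unfolding same_outside_def in_subtree by blast+
      have eq: "inner t u e y = inner t u e x @ [i] \<longleftrightarrow> inner t u e' y = inner t u e' x @ [i]"
        "inner t u e y = u \<longleftrightarrow> inner t u e' y = u"
        using ins by (simp_all add: same_inside_def)
      have "e' y = e' x @ [i]"
      proof (cases "y \<in> P")
        case True
        show ?thesis
        proof (cases "x \<in> P")
          case True
          with \<open>y \<in> P\<close> show ?thesis using eq(1) y xP yP 1 by (simp add: inner_def)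
        next
          case False
          then have "e x = e' x" using out by (simp add: same_outside_def)
          moreover have "e y = u" using False \<open>y \<in> P\<close> y xP yP by (simp add: prefix_snoc)
          moreover have "e' y = u" using \<open>e y = u\<close> eq(2) \<open>y \<in> P\<close> yP 1 by (simp add: inner_def)
          ultimately show ?thesis using y by simp
        qed
      next
        case False
        then have "x \<notin> P" using y xP yP by (auto simp: prefix_snoc)
        with False show ?thesis using y out by (simp add: same_outside_def)
      qed
      then show "sat (tree_struct t) e' s' (Rel R xs)" using 1 by (auto simp: Succ xs tree_struct_def)
    qed
    moreover have "\<forall>\<theta>\<in>?\<Theta>. definable_test \<Sigma> \<theta>"
      by (simp add: definable_test_def definable_succ definable_eq)
    ultimately show ?thesis by (intro exI[of _ ?\<Theta>] conjI) simp_all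
  next
    case (Label a)
    with Rel have "length xs = 1" and a: "a \<in> \<Sigma>" by (auto simp: tree_signature_def)
    then obtain x where xs: "xs = [x]" by (auto simp: length_Suc_conv)
    let ?\<Theta> = "{\<lambda>t u e s. t (e x) = Some a}"
    have "determines \<Sigma> P ?\<Theta> (Rel R xs)"
    proof (rule determinesI)
      fix t u e s e' s'
      assume out: "same_outside t u P e s e' s'" and ins: "same_inside ?\<Theta> t u e s e' s'"
        and "sat (tree_struct t) e s (Rel R xs)"
      then have "t (e x) = Some a" by (simp add: Label xs tree_struct_def)
      moreover have "e x \<in> subtree (dom t) u \<longleftrightarrow> x \<in> P" "e' x \<in> subtree (dom t) u \<longleftrightarrow> x \<in> P"
        "x \<notin> P \<longrightarrow> e x = e' x"
        using out unfolding same_outside_def by blast+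
      moreover have "t (inner t u e x) = Some a \<longleftrightarrow> t (inner t u e' x) = Some a"
        using ins by (simp add: same_inside_def)
      ultimately have "t (e' x) = Some a" by (cases "x \<in> P") (simp_all add: inner_def)
      then show "sat (tree_struct t) e' s' (Rel R xs)" by (simp add: Label xs tree_struct_def)
    qed
    moreover have "\<forall>\<theta>\<in>?\<Theta>. definable_test \<Sigma> \<theta>"
      by (simp add: definable_test_def definable_label a)
    ultimately show ?thesis by (intro exI[of _ ?\<Theta>] conjI) simp_all
  qed
next
  case (Eq x y)
  let ?\<Theta> = "{\<lambda>t u e s. e x = e y}"
  have "determines \<Sigma> P ?\<Theta> (Eq x y)"
  proof (rule determinesI)
    fix t u e s e' s'
    assume out: "same_outside t u P e s e' s'" and ins: "same_inside ?\<Theta> t u e s e' s'"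
      and "sat (tree_struct t) e s (Eq x y)"
    then have eq: "e x = e y" by simp
    then have "x \<in> P \<longleftrightarrow> y \<in> P" using out by (metis same_outside_def)
    moreover have "inner t u e x = inner t u e y \<longleftrightarrow> inner t u e' x = inner t u e' y"
      using ins by (simp add: same_inside_def)
    ultimately show "sat (tree_struct t) e' s' (Eq x y)"
      using out eq by (cases "x \<in> P") (simp_all add: same_outside_def inner_def)
  qed
  moreover have "\<forall>\<theta>\<in>?\<Theta>. definable_test \<Sigma> \<theta>"
    by (simp add: definable_test_def definable_eq)
  ultimately show ?case by (intro exI[of _ ?\<Theta>] conjI) simp_all
next
  case (Mem x X)
  let ?\<Theta> = "{\<lambda>t u e s. e x \<in> s X}"
  have "determines \<Sigma> P ?\<Theta> (Mem x X)"
  proof (rule determinesI)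
    fix t u e s e' s'
    assume out: "same_outside t u P e s e' s'" and ins: "same_inside ?\<Theta> t u e s e' s'"
      and "sat (tree_struct t) e s (Mem x X)"
    then have m: "e x \<in> s X" by simp
    show "sat (tree_struct t) e' s' (Mem x X)"
    proof (cases "x \<in> P")
      case True
      then have "e x \<in> subtree (dom t) u" "e' x \<in> subtree (dom t) u"
        using out unfolding same_outside_def by blast+
      then show ?thesis using ins m unfolding same_inside_def inner_def by simp
    next
      case False
      then have "e x \<notin> subtree (dom t) u" "e x = e' x" "s X - subtree (dom t) u = s' X - subtree (dom t) u"
        using out unfolding same_outside_def by blast+
      then have "e' x \<in> s' X" using m by (metis Diff_iff)
      then show ?thesis by simp
    qed
  qed
  moreover have "\<forall>\<theta>\<in>?\<Theta>. definable_test \<Sigma> \<theta>"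
    by (simp add: definable_test_def definable_mem)
  ultimately show ?case by (intro exI[of _ ?\<Theta>] conjI) simp_all
next
  case (Neg \<phi>)
  then obtain \<Theta> where \<Theta>: "finite \<Theta>" "\<forall>\<theta>\<in>\<Theta>. definable_test \<Sigma> \<theta>" "determines \<Sigma> P \<Theta> \<phi>"
    by (metis wf_wmso.simps(4))
  from \<Theta>(3) have "determines \<Sigma> P \<Theta> (Neg \<phi>)"
    unfolding determines_def using determinesD[OF \<Theta>(3)] by (simp only: sat.simps) blast
  with \<Theta>(1,2) show ?case by (intro exI[of _ \<Theta>] conjI)
next
  case (Conj \<phi> \<psi>)
  then have wf: "wf_wmso (tree_signature \<Sigma>) \<phi>" "wf_wmso (tree_signature \<Sigma>) \<psi>" by simp_all
  obtain \<Theta>1 where \<Theta>1: "finite \<Theta>1" "\<forall>\<theta>\<in>\<Theta>1. definable_test \<Sigma> \<theta>" "determines \<Sigma> P \<Theta>1 \<phi>"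
    using Conj.IH(1)[OF wf(1)] by blast
  obtain \<Theta>2 where \<Theta>2: "finite \<Theta>2" "\<forall>\<theta>\<in>\<Theta>2. definable_test \<Sigma> \<theta>" "determines \<Sigma> P \<Theta>2 \<psi>"
    using Conj.IH(2)[OF wf(2)] by blast
  have "determines \<Sigma> P (\<Theta>1 \<union> \<Theta>2) (Conj \<phi> \<psi>)"
  proof (rule determinesI)
    fix t u e s e' s'
    assume t: "is_tree \<Sigma> t" and out: "same_outside t u P e s e' s'"
      and ins: "same_inside (\<Theta>1 \<union> \<Theta>2) t u e s e' s'" and sat: "sat (tree_struct t) e s (Conj \<phi> \<psi>)"
    show "sat (tree_struct t) e' s' (Conj \<phi> \<psi>)"
      using sat determinesD[OF \<Theta>1(3) t out same_inside_mono[OF ins Un_upper1]]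
        determinesD[OF \<Theta>2(3) t out same_inside_mono[OF ins Un_upper2]] by simp
  qed
  with \<Theta>1(1,2) \<Theta>2(1,2) show ?case
    by (intro exI[of _ "\<Theta>1 \<union> \<Theta>2"] conjI ballI) (blast intro: finite_UnI)+
next
  case (ExElem x \<phi>)
  then have wf: "wf_wmso (tree_signature \<Sigma>) \<phi>" by simp
  obtain \<Theta>1 where \<Theta>1: "finite \<Theta>1" "\<forall>\<theta>\<in>\<Theta>1. definable_test \<Sigma> \<theta>" "determines \<Sigma> (insert x P) \<Theta>1 \<phi>"
    using ExElem.IH[OF wf] by blast
  obtain \<Theta>2 where \<Theta>2: "finite \<Theta>2" "\<forall>\<theta>\<in>\<Theta>2. definable_test \<Sigma> \<theta>" "determines \<Sigma> (P - {x}) \<Theta>2 \<phi>"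
    using ExElem.IH[OF wf] by blast
  show ?case
  proof (intro exI conjI)
    show "finite (elem_types x \<Theta>1 \<union> reset_tests x \<Theta>2)"
      using \<Theta>1(1) \<Theta>2(1) by (simp add: elem_types_def reset_tests_def)
    show "\<forall>\<theta>\<in>elem_types x \<Theta>1 \<union> reset_tests x \<Theta>2. definable_test \<Sigma> \<theta>"
      using definable_elem_types[OF \<Theta>1(1,2)] definable_reset_tests[OF \<Theta>2(2)] by blast
    show "determines \<Sigma> P (elem_types x \<Theta>1 \<union> reset_tests x \<Theta>2) (ExElem x \<phi>)"
      using \<Theta>1(3) \<Theta>2(3) by (rule determines_ex_elem)
  qed
next
  case (ExSet X \<phi>)
  then have wf: "wf_wmso (tree_signature \<Sigma>) \<phi>" by simp
  obtain \<Theta> where \<Theta>: "finite \<Theta>" "\<forall>\<theta>\<in>\<Theta>. definable_test \<Sigma> \<theta>" "determines \<Sigma> P \<Theta> \<phi>"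
    using ExSet.IH[OF wf] by blast
  show ?case
  proof (intro exI conjI)
    show "finite (set_types X \<Theta>)"
      using \<Theta>(1) by (simp add: set_types_def)
    show "\<forall>\<theta>\<in>set_types X \<Theta>. definable_test \<Sigma> \<theta>"
      using definable_set_types[OF \<Theta>(1,2)] by blast
    show "determines \<Sigma> P (set_types X \<Theta>) (ExSet X \<phi>)"
      using \<Theta>(3) by (rule determines_ex_set)
  qed
qed

text \<open>Composition for \<open>R\<close> in the case that \<open>Y\<close> is empty below
  \<open>u\<close>: the type of \<open>X\<close> is the set of tests passed by its inner part. Types
  are numbered because they later serve as depths of nodes.\<close>

lemma finitely_many_subtree_types:
  assumes "definable \<Sigma> (\<lambda>t e s. R t (s 0) (s 1))"
  obtains K :: nat and tp :: "'a tree \<Rightarrow> bool list \<Rightarrow> bool list set \<Rightarrow> nat" where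
    "\<And>t u X. tp t u X < K"
    "\<And>i j k. definable \<Sigma> (\<lambda>t e s. tp t (e i) (s j) = k)"
    "\<And>t u X X'. X \<inter> subtree (dom t) u = X' \<inter> subtree (dom t) u \<Longrightarrow> tp t u X = tp t u X'"
    "\<And>t u X X' Y. is_tree \<Sigma> t \<Longrightarrow> u \<in> dom t \<Longrightarrow> finite X \<Longrightarrow> X \<subseteq> dom t \<Longrightarrow> finite X' \<Longrightarrow> X' \<subseteq> dom t \<Longrightarrow>
       finite Y \<Longrightarrow> Y \<subseteq> dom t \<Longrightarrow> X - subtree (dom t) u = X' - subtree (dom t) u \<Longrightarrow> tp t u X = tp t u X' \<Longrightarrow>
       Y \<inter> subtree (dom t) u = {} \<Longrightarrow> R t X Y \<Longrightarrow> R t X' Y"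
proof -
  from assms obtain \<phi> where \<phi>: "wf_wmso (tree_signature \<Sigma>) \<phi>"
    "\<And>t e s. is_tree \<Sigma> t \<Longrightarrow> valuation t e s \<Longrightarrow> sat (tree_struct t) e s \<phi> \<longleftrightarrow> R t (s 0) (s 1)"
    unfolding definable_def by blast
  \<comment> \<open>The relation \<open>R\<close> speaks of sets only, so all element variables may
    be placed at \<open>u\<close>, hence inside the subtree: \<open>P\<close> is
    \<open>UNIV\<close>.\<close>
  obtain \<Theta> where \<Theta>: "finite \<Theta>" "\<forall>\<theta>\<in>\<Theta>. definable_test \<Sigma> \<theta>" "determines \<Sigma> UNIV \<Theta> \<phi>"
    using composition[OF \<phi>(1)] by blast
  obtain c K where c: "bij_betw c (Pow \<Theta>) {0..<(K::nat)}"
    using ex_bij_betw_finite_nat[of "Pow \<Theta>"] \<Theta>(1) by blast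
  \<comment> \<open>Set variable 0 stands for \<open>X\<close> and every other one for
    \<open>Y\<close>, whose part in the subtree is empty.\<close>
  define args where "args = (\<lambda>(t :: 'a tree) u X (i::nat). if i = 0 then X \<inter> subtree (dom t) u else {})"
  define passed where "passed = (\<lambda>t u X. {\<theta> \<in> \<Theta>. \<theta> t u (\<lambda>_. u) (args t u X)})"
  define tp where "tp = (\<lambda>t u X. c (passed t u X))"
  have passed: "passed t u X \<in> Pow \<Theta>" for t u X by (auto simp: passed_def)
  show thesis
  proof (rule that)
    show "tp t u X < K" for t u X
      using bij_betwE[OF c] passed by (fastforce simp: tp_def)
    show "tp t u X = tp t u X'" if "X \<inter> subtree (dom t) u = X' \<inter> subtree (dom t) u" for t u X X'
      unfolding tp_def passed_def args_def that ..
    show "definable \<Sigma> (\<lambda>t e s. tp t (e i) (s j) = k)" for i j k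
    proof (rule definable_cong)
      have "definable \<Sigma> (\<lambda>t e s. \<theta> t (e i) (\<lambda>_. e i) (args t (e i) (s j)))" if "\<theta> \<in> \<Theta>" for \<theta>
      proof (rule definable_cong)
        \<comment> \<open>The arguments of a test must be values of variables, so the inner part of
          \<open>X\<close> and the empty set are named by quantified sets \<open>Z\<close> and
          \<open>W\<close> below. There \<open>W\<close>, quantified last, is variable 0 and
          \<open>Z\<close> is variable 1, which explains the indices.\<close>
        have "definable \<Sigma> (\<lambda>t e s. \<theta> t (e i) (\<lambda>_. e i) (\<lambda>n. s (if n = 0 then 1 else 0)))"
          using definable_rename[of \<Sigma> "\<lambda>t e s. \<theta> t (e 0) (\<lambda>i. e (Suc i)) s" "\<lambda>_. i"
              "\<lambda>n. if n = 0 then 1 else 0"] \<Theta>(2) that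
          by (simp add: definable_test_def)
        then have *: "definable \<Sigma> (\<lambda>t e s. \<theta> t (e i) (\<lambda>_. e i) (\<lambda>n. if n = 0 then s (Suc 0) else s 0))"
          by (simp add: if_distrib cong: if_cong)
        show "definable \<Sigma> (\<lambda>t e s. \<exists>Z. finite Z \<and> Z \<subseteq> dom t \<and> (\<exists>W. finite W \<and> W \<subseteq> dom t \<and>
            (\<forall>v\<in>dom t. v \<in> Z \<longleftrightarrow> v \<in> s j \<and> prefix (e i) v) \<and> (\<forall>v\<in>dom t. v \<notin> W) \<and>
            \<theta> t (e i) (\<lambda>_. e i) (\<lambda>n. if n = 0 then Z else W)))"
          by (intro definable_intros definable_prefix *)
      next
        fix t :: "'a tree" and e :: "nat \<Rightarrow> bool list" and s :: "nat \<Rightarrow> bool list set"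
        assume "valuation t e s"
        then have s: "finite (s j)" "s j \<subseteq> dom t" by (simp_all add: valuation_def)
        show "\<theta> t (e i) (\<lambda>_. e i) (args t (e i) (s j)) \<longleftrightarrow>
            (\<exists>Z. finite Z \<and> Z \<subseteq> dom t \<and> (\<exists>W. finite W \<and> W \<subseteq> dom t \<and>
            (\<forall>v\<in>dom t. v \<in> Z \<longleftrightarrow> v \<in> s j \<and> prefix (e i) v) \<and> (\<forall>v\<in>dom t. v \<notin> W) \<and>
            \<theta> t (e i) (\<lambda>_. e i) (\<lambda>n. if n = 0 then Z else W)))" (is "?L \<longleftrightarrow> ?R")
        proof
          assume ?L
          moreover have "\<forall>v\<in>dom t. v \<in> s j \<inter> subtree (dom t) (e i) \<longleftrightarrow> v \<in> s j \<and> prefix (e i) v"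
            unfolding Int_iff in_subtree by blast
          moreover have "finite (s j \<inter> subtree (dom t) (e i))" "s j \<inter> subtree (dom t) (e i) \<subseteq> dom t"
            "finite {}" "{} \<subseteq> dom t" "\<forall>v\<in>dom t. v \<notin> {}"
            using s by blast+
          ultimately show ?R unfolding args_def by blast
        next
          assume ?R
          then obtain Z W where Z: "Z \<subseteq> dom t" "\<forall>v\<in>dom t. v \<in> Z \<longleftrightarrow> v \<in> s j \<and> prefix (e i) v"
            and W: "W \<subseteq> dom t" "\<forall>v\<in>dom t. v \<notin> W"
            and \<theta>: "\<theta> t (e i) (\<lambda>_. e i) (\<lambda>n. if n = 0 then Z else W)"
            by blast
          have Zeq: "Z = s j \<inter> subtree (dom t) (e i)"
            unfolding set_eq_iff Int_iff in_subtree using Z by blast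
          have Weq: "W = {}" using W by blast
          show ?L using \<theta> unfolding Zeq Weq args_def .
        qed
      qed
      then show "definable \<Sigma> (\<lambda>t e s. \<exists>S\<in>{S \<in> Pow \<Theta>. c S = k}.
          \<forall>\<theta>\<in>\<Theta>. \<theta> t (e i) (\<lambda>_. e i) (args t (e i) (s j)) \<longleftrightarrow> \<theta> \<in> S)"
        using \<Theta>(1) by (intro definable_bex definable_ball definable_iff definable_const) auto
      show "tp t (e i) (s j) = k \<longleftrightarrow> (\<exists>S\<in>{S \<in> Pow \<Theta>. c S = k}.
          \<forall>\<theta>\<in>\<Theta>. \<theta> t (e i) (\<lambda>_. e i) (args t (e i) (s j)) \<longleftrightarrow> \<theta> \<in> S)" (is "?L \<longleftrightarrow> ?R") for t e s
      proof
        assume ?L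
        then show ?R using passed[of t "e i" "s j"]
          by (intro bexI[of _ "passed t (e i) (s j)"]) (auto simp: tp_def passed_def)
      next
        assume ?R
        then obtain S where S: "S \<subseteq> \<Theta>" "c S = k"
          "\<forall>\<theta>\<in>\<Theta>. \<theta> t (e i) (\<lambda>_. e i) (args t (e i) (s j)) \<longleftrightarrow> \<theta> \<in> S" by auto
        then have "passed t (e i) (s j) = S" by (auto simp: passed_def)
        with S show ?L by (simp add: tp_def)
      qed
    qed
  next
    fix t u X X' Y
    assume t: "is_tree \<Sigma> t" and fin: "u \<in> dom t" "finite X" "X \<subseteq> dom t" "finite X'" "X' \<subseteq> dom t"
       "finite Y" "Y \<subseteq> dom t" and out: "X - subtree (dom t) u = X' - subtree (dom t) u"
       and tp: "tp t u X = tp t u X'" and Y: "Y \<inter> subtree (dom t) u = {}" and R: "R t X Y"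
    let ?e = "\<lambda>_::nat. u" and ?s = "\<lambda>X (i::nat). if i = 0 then X else Y"
    have val: "valuation t ?e (?s X)" "valuation t ?e (?s X')"
      using fin by (auto simp: valuation_def)
    have so: "same_outside t u UNIV ?e (?s X) ?e (?s X')"
      using fin val out by (simp add: same_outside_def)
    have "inner t u ?e = ?e" by (simp add: inner_def)
    moreover have "(\<lambda>i. ?s Z i \<inter> subtree (dom t) u) = args t u Z" for Z
      using Y by (intro ext) (auto simp: args_def)
    moreover have "passed t u X = passed t u X'"
      using tp bij_betw_imp_inj_on[OF c] passed unfolding tp_def by (metis inj_onD)
    ultimately have "same_inside \<Theta> t u ?e (?s X) ?e (?s X')"
      unfolding same_inside_def by (auto simp: passed_def)
    from determinesD[OF \<Theta>(3) t so this] show "R t X' Y"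
      using R \<phi>(2)[OF t val(1)] \<phi>(2)[OF t val(2)] by simp
  qed
qed

section \<open>Codes of classes\<close>

definition set_less :: "'a::linorder set \<Rightarrow> 'a set \<Rightarrow> bool" where
  "set_less U V \<longleftrightarrow> (\<exists>x. x \<in> U \<and> x \<notin> V \<and> (\<forall>y. y < x \<longrightarrow> (y \<in> U \<longleftrightarrow> y \<in> V)))"

lemma set_less_irrefl: "\<not> set_less U U"
  by (simp add: set_less_def)

lemma set_less_trans:
  assumes "set_less U V" "set_less V W"
  shows "set_less U W"
proof -
  from assms obtain x y where x: "x \<in> U" "x \<notin> V" "\<And>z. z < x \<Longrightarrow> z \<in> U \<longleftrightarrow> z \<in> V"
    and y: "y \<in> V" "y \<notin> W" "\<And>z. z < y \<Longrightarrow> z \<in> V \<longleftrightarrow> z \<in> W"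
    unfolding set_less_def by blast
  show ?thesis
    unfolding set_less_def
  proof (intro exI[of _ "min x y"] conjI allI impI)
    have "x \<noteq> y" using x y by blast
    then have "(x < y \<and> min x y = x) \<or> (y < x \<and> min x y = y)" by (auto simp: min_def)
    then show "min x y \<in> U" "min x y \<notin> W" using x y by metis+
    show "z \<in> U \<longleftrightarrow> z \<in> W" if "z < min x y" for z
      using that x(3)[of z] y(3)[of z] by simp
  qed
qed

text \<open>Finiteness provides a least point of difference; the lexicographic order on words, to
  which this is applied, is not well-founded.\<close>

lemma set_less_total:
  assumes "finite U" "finite V" "U \<noteq> V"
  shows "set_less U V \<or> set_less V U"
proof -
  let ?D = "(U - V) \<union> (V - U)"
  have D: "finite ?D" "?D \<noteq> {}" using assms by auto
  have "y \<in> U \<longleftrightarrow> y \<in> V" if "y < Min ?D" for y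
    using that D(1) by (metis DiffI Min_le UnCI leD)
  with Min_in[OF D] show ?thesis unfolding set_less_def by blast
qed

lemma least_set_exists:
  assumes "finite K" "K \<noteq> {}"
  shows "\<exists>U\<in>K. \<forall>V\<in>K. \<not> set_less V U"
  using assms
proof (induction K rule: finite_ne_induct)
  case (singleton U)
  then show ?case by (simp add: set_less_irrefl)
next
  case (insert W K)
  then obtain U where U: "U \<in> K" "\<forall>V\<in>K. \<not> set_less V U" by blast
  show ?case
  proof (cases "set_less W U")
    case True
    then show ?thesis using U by (intro bexI[of _ W]) (auto simp: set_less_irrefl dest: set_less_trans)
  next
    case False
    then show ?thesis using U by blast
  qed
qed

section \<open>Infinite subtrees, markers and codes\<close>

definition big :: "bool list set \<Rightarrow> bool list \<Rightarrow> bool" where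
  "big T u \<longleftrightarrow> u \<in> T \<and> infinite (subtree T u)"

text \<open>From a node with infinite subtree, iteration follows the leftmost branch whose nodes all
  have infinite subtrees. This is a path of unbounded length that requires no choice.\<close>

definition nxt :: "bool list set \<Rightarrow> bool list \<Rightarrow> bool list" where
  "nxt T u = (if big T (u @ [False]) then u @ [False] else u @ [True])"

text \<open>The depth is \<open>Suc i\<close> so that type 0 also yields two distinct nodes. The
  node \<open>u\<close> shows where the subtree was cut off, the other one encodes the type.\<close>

definition marker :: "bool list set \<Rightarrow> bool list \<Rightarrow> nat \<Rightarrow> bool list set" where
  "marker T u i = {u, (nxt T ^^ Suc i) u}"

definition free :: "bool list set \<Rightarrow> (bool list set \<times> bool list set) set \<Rightarrow> bool list set \<Rightarrow> bool list \<Rightarrow> bool" where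
  "free T E X u \<longleftrightarrow> big T u \<and> (\<exists>Y. (X, Y) \<in> E \<and> Y \<inter> subtree T u = {})"

definition border :: "bool list set \<Rightarrow> (bool list set \<times> bool list set) set \<Rightarrow> bool list set \<Rightarrow> bool list \<Rightarrow> bool" where
  "border T E X u \<longleftrightarrow> free T E X u \<and> (\<forall>v\<in>T. prefix v u \<longrightarrow> v \<noteq> u \<longrightarrow> \<not> free T E X v)"

definition code :: "bool list set \<Rightarrow> (bool list set \<times> bool list set) set \<Rightarrow>
    (bool list \<Rightarrow> bool list set \<Rightarrow> nat) \<Rightarrow> bool list set \<Rightarrow> bool list set \<Rightarrow> bool" where
  "code T E tp X U \<longleftrightarrow> finite U \<and> U \<subseteq> T \<and>
     (\<forall>v\<in>T. (\<forall>u\<in>T. border T E X u \<longrightarrow> \<not> prefix u v) \<longrightarrow> (v \<in> U \<longleftrightarrow> v \<in> X)) \<and>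
     (\<forall>u\<in>T. border T E X u \<longrightarrow> U \<inter> subtree T u = marker T u (tp u X))"

text \<open>Minimality ranges over the codes of all members of the class and not only over those of
  \<open>X\<close>, since each of them represents the class.\<close>

definition canonical :: "bool list set \<Rightarrow> (bool list set \<times> bool list set) set \<Rightarrow>
    (bool list \<Rightarrow> bool list set \<Rightarrow> nat) \<Rightarrow> bool list set \<Rightarrow> bool" where
  "canonical T E tp U \<longleftrightarrow> (\<exists>X. (X, X) \<in> E \<and> code T E tp X U \<and>
     (\<forall>X' U'. (X, X') \<in> E \<longrightarrow> code T E tp X' U' \<longrightarrow> \<not> set_less U' U))"

lemma subtree_mono: "prefix u v \<Longrightarrow> subtree A v \<subseteq> subtree A u"
  unfolding subset_iff in_subtree by (blast intro: prefix_order.trans)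

locale prefix_closed_set =
  fixes T :: "bool list set"
  assumes closed: "v \<in> T \<Longrightarrow> prefix u v \<Longrightarrow> u \<in> T"
begin

abbreviation "Big \<equiv> big T"
abbreviation "Next \<equiv> nxt T"

text \<open>The step of Koenig's lemma: an infinite subtree consists of its root and at most two
  smaller subtrees, one of which is infinite.\<close>

lemma big_next:
  assumes "Big u"
  shows "Big (Next u)"
proof -
  have "subtree T u \<subseteq> {u} \<union> subtree T (u @ [False]) \<union> subtree T (u @ [True])"
  proof
    fix v assume v: "v \<in> subtree T u"
    then obtain w where w: "v = u @ w" by (auto simp: prefix_def)
    show "v \<in> {u} \<union> subtree T (u @ [False]) \<union> subtree T (u @ [True])"
    proof (cases w)
      case (Cons b w')
      then show ?thesis using v w by (cases b) auto
    qed (use w in simp)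
  qed
  then have inf: "infinite (subtree T (u @ [False])) \<or> infinite (subtree T (u @ [True]))"
    using assms unfolding big_def by (metis finite.emptyI finite.insertI finite_UnI finite_subset)
  have "Big v" if "infinite (subtree T v)" for v
  proof -
    have "subtree T v \<noteq> {}" using that by (metis finite.emptyI)
    then obtain w where "w \<in> subtree T v" by blast
    then have "v \<in> T" using closed unfolding in_subtree by blast
    then show ?thesis using that by (simp add: big_def)
  qed
  with inf show ?thesis by (auto simp: nxt_def)
qed

lemma next_pow:
  assumes "Big u"
  shows "Big ((Next ^^ n) u) \<and> prefix u ((Next ^^ n) u) \<and> length ((Next ^^ n) u) = length u + n"
  using assms
proof (induction n)
  case (Suc n)
  then show ?case using big_next by (auto simp: nxt_def)
qed simp

lemma next_pow_inject:
  assumes "Big u"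
  shows "(Next ^^ m) u = (Next ^^ n) u \<longleftrightarrow> m = n"
proof
  assume "(Next ^^ m) u = (Next ^^ n) u"
  then have "length ((Next ^^ m) u) = length ((Next ^^ n) u)" by (rule arg_cong)
  moreover have "length ((Next ^^ k) u) = length u + k" for k using next_pow[OF assms] by blast
  ultimately show "m = n" by simp
qed simp

lemma next_pow_neq: "Big u \<Longrightarrow> (Next ^^ Suc i) u \<noteq> u"
  using next_pow_inject[of u "Suc i" 0] by simp

lemma marker_inject:
  assumes "Big u"
  shows "marker T u i = marker T u j \<longleftrightarrow> i = j"
  unfolding marker_def doubleton_eq_iff next_pow_inject[OF assms] nat.inject
  using next_pow_neq[OF assms] by metis

lemma card_marker: "Big u \<Longrightarrow> card (marker T u i) = 2"
  unfolding marker_def using next_pow_neq[of u i] card_2_iff by metis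

lemma marker_subset: "Big u \<Longrightarrow> marker T u i \<subseteq> subtree T u"
  using next_pow[of u "Suc i"] unfolding marker_def by (auto simp: big_def)

lemma big_closed: "Big v \<Longrightarrow> prefix u v \<Longrightarrow> Big u"
  using closed[of v u] infinite_super[OF subtree_mono[of u v T]] by (simp add: big_def)

end

text \<open>Isolates what the combinatorics needs from logic. The swap is demanded only for partners
  \<open>Y\<close> that avoid the subtree; freeness of a node supplies exactly such a member of the
  class.\<close>

locale class_coding = prefix_closed_set +
  fixes V :: "bool list set set"
    and E :: "(bool list set \<times> bool list set) set"
    and tp :: "bool list \<Rightarrow> bool list set \<Rightarrow> nat" and K :: nat
  assumes equiv: "equiv V E"
    and carrier: "X \<in> V \<Longrightarrow> finite X \<and> X \<subseteq> T"
    and tp_less: "tp u X < K"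
    and tp_local: "X \<inter> subtree T u = X' \<inter> subtree T u \<Longrightarrow> tp u X = tp u X'"
    and tp_swap: "u \<in> T \<Longrightarrow> finite X \<Longrightarrow> X \<subseteq> T \<Longrightarrow> finite X' \<Longrightarrow> X' \<subseteq> T \<Longrightarrow> finite Y \<Longrightarrow> Y \<subseteq> T \<Longrightarrow>
      X - subtree T u = X' - subtree T u \<Longrightarrow> tp u X = tp u X' \<Longrightarrow> Y \<inter> subtree T u = {} \<Longrightarrow>
      (X, Y) \<in> E \<Longrightarrow> (X', Y) \<in> E"
begin

abbreviation "Free \<equiv> free T E"
abbreviation "Border \<equiv> border T E"
abbreviation "Code \<equiv> code T E tp"

lemma E_carrier: "(X, Y) \<in> E \<Longrightarrow> X \<in> V \<and> Y \<in> V"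
  using equiv by (auto simp: equiv_def refl_on_def)

lemma E_refl: "X \<in> V \<Longrightarrow> (X, X) \<in> E"
  using equiv by (simp add: equiv_def refl_on_def)

lemma E_sym: "(X, Y) \<in> E \<Longrightarrow> (Y, X) \<in> E"
  using equiv by (meson equiv_def symD)

lemma E_trans: "(X, Y) \<in> E \<Longrightarrow> (Y, Z) \<in> E \<Longrightarrow> (X, Z) \<in> E"
  using equiv by (meson equiv_def transD)

lemma free_big: "Free X u \<Longrightarrow> Big u"
  by (simp add: free_def)

lemma border_free: "Border X u \<Longrightarrow> Free X u"
  by (simp add: border_def)

lemma border_in: "Border X u \<Longrightarrow> u \<in> T"
  by (simp add: border_def free_def big_def)

lemma free_down: "Free X u \<Longrightarrow> prefix u v \<Longrightarrow> Big v \<Longrightarrow> Free X v"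
  unfolding free_def using subtree_mono[of u v T] by blast

lemma free_cong: "(X, X') \<in> E \<Longrightarrow> Free X u \<longleftrightarrow> Free X' u"
  unfolding free_def using E_trans E_sym by blast

lemma border_cong: "(X, X') \<in> E \<Longrightarrow> Border X u \<longleftrightarrow> Border X' u"
  unfolding border_def using free_cong by blast

lemma border_above_free:
  assumes "Free X v"
  shows "\<exists>u. Border X u \<and> prefix u v"
  using assms
proof (induction "length v" arbitrary: v rule: less_induct)
  case less
  show ?case
  proof (cases "Border X v")
    case False
    then obtain w where w: "prefix w v" "w \<noteq> v" "Free X w" using less.prems by (auto simp: border_def)
    then have "length w < length v" by (simp add: prefix_length_less prefix_order.le_neq_trans)
    from less.hyps[OF this w(3)] w(1) show ?thesis by (meson prefix_order.trans)
  qed blast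
qed

lemma border_antichain: "Border X u \<Longrightarrow> Border X w \<Longrightarrow> prefix u w \<Longrightarrow> u = w"
  unfolding border_def free_def big_def by blast

lemma border_disjoint:
  assumes "Border X u" "Border X w" "u \<noteq> w"
  shows "subtree T u \<inter> subtree T w = {}"
proof -
  have False if "prefix u v" "prefix w v" for v
    using prefix_same_cases[OF that] border_antichain assms by metis
  then show ?thesis by auto
qed

definition inner_nodes :: "bool list set \<Rightarrow> bool list set" where
  "inner_nodes X = {u. Big u \<and> \<not> Free X u}"

definition region :: "bool list set \<Rightarrow> bool list set" where
  "region X = {v \<in> T. \<forall>u\<in>T. Border X u \<longrightarrow> \<not> prefix u v}"

text \<open>Since \<open>X\<close> belongs to its own class, a big node whose subtree misses
  \<open>X\<close> is free. Inner nodes are therefore prefixes of elements of the finite set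
  \<open>X\<close>.\<close>

lemma finite_inner_nodes:
  assumes "X \<in> V"
  shows "finite (inner_nodes X)"
proof (rule finite_subset)
  show "inner_nodes X \<subseteq> (\<Union>x\<in>X. set (prefixes x))"
  proof
    fix u assume "u \<in> inner_nodes X"
    then have "X \<inter> subtree T u \<noteq> {}"
      using E_refl[OF assms] unfolding inner_nodes_def free_def by blast
    then show "u \<in> (\<Union>x\<in>X. set (prefixes x))" by auto
  qed
  show "finite (\<Union>x\<in>X. set (prefixes x))" using carrier[OF assms] by simp
qed

lemma region_prefix_closed: "v \<in> region X \<Longrightarrow> prefix u v \<Longrightarrow> u \<in> region X"
  unfolding region_def using closed[of v u] prefix_order.trans[of _ u v] by blast

text \<open>Big nodes of the region are not free, hence inner. Any other node of the region has a
  topmost ancestor that is not big, collected in \<open>W\<close>: it is the root or a child of an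
  inner node, and its subtree is finite.\<close>

lemma finite_region:
  assumes "X \<in> V"
  shows "finite (region X)"
proof (rule finite_subset)
  define W where "W = {w \<in> {[]} \<union> (\<lambda>(d, b). d @ [b]) ` (inner_nodes X \<times> UNIV). w \<in> T \<and> \<not> Big w}"
  have "v \<in> region X \<Longrightarrow> v \<in> inner_nodes X \<or> (\<exists>w\<in>W. prefix w v)" for v
  proof (induction v rule: rev_induct)
    case Nil
    then have "[] \<in> T" "\<not> Free X []"
      unfolding region_def using border_above_free[of X "[]"] border_in by auto
    then show ?case by (auto simp: inner_nodes_def W_def)
  next
    case (snoc b v)
    then have v: "v @ [b] \<in> T" by (simp add: region_def)
    have vR: "v \<in> region X" using region_prefix_closed[OF snoc.prems] by simp
    show ?case
    proof (cases "\<exists>w\<in>W. prefix w v")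
      case True
      then show ?thesis by (meson prefix_order.trans prefixI)
    next
      case False
      then have d: "v \<in> inner_nodes X" using snoc.IH vR by blast
      have "\<not> Free X (v @ [b])"
        using border_above_free[of X "v @ [b]"] snoc.prems border_in unfolding region_def by blast
      then show ?thesis using d v unfolding W_def by (auto simp: inner_nodes_def)
    qed
  qed
  then show "region X \<subseteq> inner_nodes X \<union> (\<Union>w\<in>W. subtree T w)"
    unfolding subset_iff Un_iff UN_iff in_subtree by (simp add: region_def)
  have "finite W" using finite_inner_nodes[OF assms] by (simp add: W_def)
  moreover have "finite (subtree T w)" if "w \<in> W" for w
    using that by (simp add: W_def big_def)
  ultimately show "finite (inner_nodes X \<union> (\<Union>w\<in>W. subtree T w))"
    using finite_inner_nodes[OF assms] by simp
qed

text \<open>The parent of a border node is big, and it is not free because border nodes are topmost;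
  so it is one of the finitely many inner nodes.\<close>

lemma finite_border:
  assumes "X \<in> V"
  shows "finite {u. Border X u}"
proof (rule finite_subset)
  show "{u. Border X u} \<subseteq> {[]} \<union> (\<lambda>(d, b). d @ [b]) ` (inner_nodes X \<times> UNIV)"
  proof
    fix u assume "u \<in> {u. Border X u}"
    then have u: "Border X u" by simp
    show "u \<in> {[]} \<union> (\<lambda>(d, b). d @ [b]) ` (inner_nodes X \<times> UNIV)"
    proof (cases u rule: rev_cases)
      case (snoc d b)
      then have "Big d" using big_closed[of u d] free_big[OF border_free[OF u]] by simp
      moreover have "\<not> Free X d" using u snoc \<open>Big d\<close> unfolding border_def by (auto simp: big_def)
      ultimately show ?thesis using snoc by (auto simp: inner_nodes_def)
    qed simp
  qed
  show "finite ({[]} \<union> (\<lambda>(d, b). d @ [b]) ` (inner_nodes X \<times> UNIV))"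
    using finite_inner_nodes[OF assms] by simp
qed

lemma code_border: "Code X U \<Longrightarrow> Border X u \<Longrightarrow> U \<inter> subtree T u = marker T u (tp u X)"
  using border_in by (simp add: code_def)

lemma code_region: "Code X U \<Longrightarrow> v \<in> region X \<Longrightarrow> v \<in> U \<longleftrightarrow> v \<in> X"
  by (simp add: code_def region_def)

lemma code_exists:
  assumes "X \<in> V"
  shows "\<exists>U. Code X U"
proof
  define M where "M = (\<Union>u\<in>{u. Border X u}. marker T u (tp u X))"
  have sub: "Border X u \<Longrightarrow> marker T u i \<subseteq> subtree T u" for u i
    using marker_subset free_big border_free by blast
  show "Code X ((X \<inter> region X) \<union> M)"
    unfolding code_def
  proof (intro conjI ballI impI)
    show "finite ((X \<inter> region X) \<union> M)"
      using finite_region[OF assms] finite_border[OF assms] by (simp add: M_def marker_def)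
    show "(X \<inter> region X) \<union> M \<subseteq> T"
      using carrier[OF assms] sub unfolding M_def by fastforce
  next
    fix v assume v: "v \<in> T" "\<forall>u\<in>T. Border X u \<longrightarrow> \<not> prefix u v"
    then have "v \<notin> M" using sub border_in unfolding M_def by fastforce
    then show "v \<in> (X \<inter> region X) \<union> M \<longleftrightarrow> v \<in> X" using v by (auto simp: region_def)
  next
    fix u assume u: "u \<in> T" "Border X u"
    have "X \<inter> region X \<inter> subtree T u = {}" using u by (auto simp: region_def)
    moreover have "M \<inter> subtree T u = marker T u (tp u X)"
    proof
      show "M \<inter> subtree T u \<subseteq> marker T u (tp u X)"
      proof
        fix v assume "v \<in> M \<inter> subtree T u"
        then obtain w where w: "Border X w" "v \<in> marker T w (tp w X)" "v \<in> subtree T u"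
          unfolding M_def by blast
        then have "w = u" using border_disjoint[OF w(1) u(2)] sub[OF w(1)] by blast
        then show "v \<in> marker T u (tp u X)" using w(2) by simp
      qed
      show "marker T u (tp u X) \<subseteq> M \<inter> subtree T u" using u(2) sub unfolding M_def by blast
    qed
    ultimately show "((X \<inter> region X) \<union> M) \<inter> subtree T u = marker T u (tp u X)" by blast
  qed
qed

text \<open>Border and region depend only on the class, and types below \<open>K\<close> bound the
  depth of markers. All codes are thus subsets of one finite set.\<close>

lemma finite_codes:
  assumes "X \<in> V"
  shows "finite {U. \<exists>X'. (X, X') \<in> E \<and> Code X' U}"
proof (rule finite_subset)
  let ?M = "\<Union>u\<in>{u. Border X u}. \<Union>i<K. marker T u i"
  show "{U. \<exists>X'. (X, X') \<in> E \<and> Code X' U} \<subseteq> Pow (region X \<union> ?M)"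
  proof (clarify)
    fix U X' v assume X': "(X, X') \<in> E" "Code X' U" and v: "v \<in> U" "v \<notin> ?M"
    have "v \<in> T" using X'(2) v(1) by (auto simp: code_def)
    moreover have False if u: "u \<in> T" "Border X u" "prefix u v" for u
    proof -
      have "U \<inter> subtree T u = marker T u (tp u X')"
        using u(1,2) X' border_cong[OF X'(1)] unfolding code_def by blast
      moreover have "v \<in> U \<inter> subtree T u" using u(3) v(1) \<open>v \<in> T\<close> by simp
      ultimately have "v \<in> marker T u (tp u X')" by (simp only:)
      then show False using v(2) u(2) tp_less by blast
    qed
    ultimately show "v \<in> region X" unfolding region_def by blast
  qed
  show "finite (Pow (region X \<union> ?M))"
    using finite_region[OF assms] finite_border[OF assms] by (simp add: marker_def)
qed

text \<open>Iterating \<open>Next\<close> yields infinitely many big nodes, of which only finitely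
  many are inner, so the path reaches a free node. The border node above that one is comparable with
  \<open>u\<close> but not a prefix of \<open>u\<close>, for otherwise freeness would pass down to
  \<open>u\<close>.\<close>

lemma border_below_inner:
  assumes "X \<in> V" "Big u" "\<not> Free X u"
  shows "\<exists>w. Border X w \<and> prefix u w \<and> u \<noteq> w"
proof -
  have "\<exists>n. Free X ((Next ^^ n) u)"
  proof (rule ccontr)
    assume "\<not> ?thesis"
    then have "range (\<lambda>n. (Next ^^ n) u) \<subseteq> inner_nodes X"
      using next_pow[OF assms(2)] unfolding inner_nodes_def by blast
    moreover have "inj (\<lambda>n. (Next ^^ n) u)"
      unfolding inj_def next_pow_inject[OF assms(2)] by blast
    ultimately show False
      using finite_inner_nodes[OF assms(1)] by (meson finite_subset finite_imageD infinite_UNIV_nat)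
  qed
  then obtain n where "Free X ((Next ^^ n) u)" ..
  from border_above_free[OF this] obtain w where w: "Border X w" "prefix w ((Next ^^ n) u)" by blast
  have "\<not> prefix w u" using free_down[OF border_free[OF w(1)]] assms(2,3) by blast
  moreover have "prefix u ((Next ^^ n) u)" using next_pow[OF assms(2)] by blast
  ultimately have "prefix u w" "u \<noteq> w" using prefix_same_cases[OF w(2)] by auto
  then show ?thesis using w(1) by blast
qed

text \<open>Counting separates the big nodes in \<open>U\<close>. At a border node the subtree holds
  exactly a marker, two nodes. A node strictly below the border is the lower node of a marker and
  alone in its subtree. A node that is not free has a whole marker strictly below it, which makes at
  least three.\<close>

lemma border_decode:
  assumes X: "X \<in> V" and U: "Code X U"
  shows "Border X u \<longleftrightarrow> Big u \<and> u \<in> U \<and> card (U \<inter> subtree T u) = 2"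
proof
  assume u: "Border X u"
  then have "U \<inter> subtree T u = marker T u (tp u X)" using U border_in by (auto simp: code_def)
  moreover have "Big u" using free_big[OF border_free[OF u]] .
  moreover have "u \<in> marker T u (tp u X)" by (simp add: marker_def)
  ultimately show "Big u \<and> u \<in> U \<and> card (U \<inter> subtree T u) = 2"
    using card_marker[of u "tp u X"] by auto
next
  assume *: "Big u \<and> u \<in> U \<and> card (U \<inter> subtree T u) = 2"
  have uT: "u \<in> T" using * by (simp add: big_def)
  show "Border X u"
  proof (cases "Free X u")
    case True
    then obtain w where w: "Border X w" "prefix w u" using border_above_free by blast
    show ?thesis
    proof (cases "w = u")
      case False
      have m: "U \<inter> subtree T w = marker T w (tp w X)" using U w(1) border_in by (auto simp: code_def)
      have "U \<inter> subtree T u \<subseteq> {u}"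
      proof
        fix v assume v: "v \<in> U \<inter> subtree T u"
        have "u \<in> subtree T w" using w(2) uT by simp
        then have "v \<in> marker T w (tp w X)" "u \<in> marker T w (tp w X)"
          unfolding m[symmetric] using v * subtree_mono[OF w(2)] by blast+
        moreover have "v \<noteq> w" using v w(2) False prefix_order.antisym by auto
        ultimately show "v \<in> {u}" using False unfolding marker_def by blast
      qed
      then have "card (U \<inter> subtree T u) \<le> 1" using card_mono[of "{u}"] by fastforce
      with * show ?thesis by simp
    qed (use w in simp)
  next
    case False
    then obtain w where w: "Border X w" "prefix u w" "u \<noteq> w" using border_below_inner X * by blast
    have m: "U \<inter> subtree T w = marker T w (tp w X)" using U w(1) border_in by (auto simp: code_def)
    have "u \<in> subtree T u" using uT by simp
    then have sub: "insert u (marker T w (tp w X)) \<subseteq> U \<inter> subtree T u"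
      unfolding m[symmetric] using * subtree_mono[OF w(2)] by blast
    have "u \<notin> marker T w (tp w X)"
      unfolding m[symmetric] using w(2,3) prefix_order.antisym by auto
    moreover have "card (marker T w (tp w X)) = 2" using card_marker free_big border_free w(1) by blast
    ultimately have "card (insert u (marker T w (tp w X))) = 3" by (simp add: marker_def)
    moreover have "finite (U \<inter> subtree T u)" using U by (simp add: code_def)
    ultimately show ?thesis using card_mono[OF _ sub] * by simp
  qed
qed

text \<open>Both arguments agree outside the subtrees at the common border, and inside they have the same
  types there, so one is turned into the other by replacing one subtree at a time.  The class has a
  member avoiding the subtree being replaced, which reduces each step to \<open>tp_swap\<close>.\<close>

lemma code_determines_class:
  assumes X: "X \<in> V" "Code X U" and X': "X' \<in> V" "Code X' U"
  shows "(X, X') \<in> E"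
proof -
  let ?B = "{u. Border X u}"
  have B: "Border X u \<longleftrightarrow> Border X' u" for u
    using border_decode[OF X] border_decode[OF X'] by blast
  have tp: "tp u X = tp u X'" if "Border X u" for u
  proof -
    have "marker T u (tp u X) = marker T u (tp u X')"
      using code_border[OF X(2)] code_border[OF X'(2)] B that by simp
    then show ?thesis using marker_inject free_big border_free that by blast
  qed
  have "region X = region X'" by (simp add: region_def B)
  then have out: "v \<in> X \<longleftrightarrow> v \<in> X'" if "v \<in> region X" for v
    using that code_region[OF X(2)] code_region[OF X'(2)] by blast
  define H where "H = (\<lambda>F. (X - \<Union>(subtree T ` F)) \<union> (X' \<inter> \<Union>(subtree T ` F)))"
  have fin: "finite (H F)" "H F \<subseteq> T" for F
    using carrier[OF X(1)] carrier[OF X'(1)] by (auto simp: H_def)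
  have "(X, H F) \<in> E" if "finite F" "F \<subseteq> ?B" for F
    using that
  proof (induction F)
    case empty
    then show ?case using E_refl X(1) by (simp add: H_def)
  next
    case (insert u F)
    then have u: "Border X u" "u \<in> T" and IH: "(X, H F) \<in> E" using border_in by auto
    obtain Y where Y: "(X, Y) \<in> E" "Y \<inter> subtree T u = {}"
      using border_free[OF u(1)] unfolding free_def by blast
    have disj: "subtree T u \<inter> \<Union>(subtree T ` F) = {}"
      using border_disjoint[OF u(1)] insert by blast
    have "H F \<inter> subtree T u = X \<inter> subtree T u" using disj unfolding H_def by blast
    moreover have "H (insert u F) \<inter> subtree T u = X' \<inter> subtree T u" unfolding H_def by blast
    ultimately have "tp u (H F) = tp u (H (insert u F))"
      using tp_local[of "H F" u X] tp_local[of "H (insert u F)" u X'] tp[OF u(1)] by simp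
    moreover have "H F - subtree T u = H (insert u F) - subtree T u" unfolding H_def by blast
    moreover have "(H F, Y) \<in> E" using IH Y(1) E_sym E_trans by blast
    moreover have "finite Y" "Y \<subseteq> T" using Y(1) E_carrier carrier by blast+
    ultimately have "(H (insert u F), Y) \<in> E"
      using tp_swap[OF u(2) fin fin] Y(2) by blast
    then show ?case using Y(1) E_sym E_trans by blast
  qed
  then have "(X, H ?B) \<in> E" using finite_border[OF X(1)] by blast
  moreover have "H ?B = X'"
  proof (rule set_eqI)
    fix v
    show "v \<in> H ?B \<longleftrightarrow> v \<in> X'"
    proof (cases "v \<in> T")
      case True
      show ?thesis
      proof (cases "\<exists>u. Border X u \<and> prefix u v")
        case in_border: True
        then have "v \<in> \<Union>(subtree T ` ?B)" using True by auto
        then show ?thesis unfolding H_def by blast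
      next
        case False
        then have "v \<notin> \<Union>(subtree T ` ?B)" "v \<in> region X" using True by (auto simp: region_def)
        then show ?thesis using out unfolding H_def by blast
      qed
    next
      case False
      then show ?thesis using fin carrier[OF X'(1)] by blast
    qed
  qed
  ultimately show ?thesis by simp
qed

lemma canonical_code_exists:
  assumes "X \<in> V"
  shows "\<exists>U X'. canonical T E tp U \<and> (X, X') \<in> E \<and> Code X' U"
proof -
  let ?K = "{U. \<exists>X'. (X, X') \<in> E \<and> Code X' U}"
  have "?K \<noteq> {}" using code_exists[OF assms] E_refl[OF assms] by blast
  from least_set_exists[OF finite_codes[OF assms] this] obtain U X' where
    U: "(X, X') \<in> E" "Code X' U" "\<forall>W\<in>?K. \<not> set_less W U" by blast
  then have "canonical T E tp U"
    unfolding canonical_def using E_trans E_refl E_carrier by blast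
  with U show ?thesis by blast
qed

text \<open>The sets witnessing canonicity may differ from \<open>X\<close> and \<open>X'\<close>,
  but sets with a common code are equivalent. So both codes are minimal in the same class, and
  totality of the order forces equality.\<close>

lemma canonical_code_unique:
  assumes "canonical T E tp U" "canonical T E tp U'" "Code X U" "Code X' U'" "(X, X') \<in> E"
  shows "U = U'"
proof -
  have V: "X \<in> V" "X' \<in> V" using assms(5) E_carrier by blast+
  obtain Y where Y: "(Y, Y) \<in> E" "Code Y U" "\<And>Z W. (Y, Z) \<in> E \<Longrightarrow> Code Z W \<Longrightarrow> \<not> set_less W U"
    using assms(1) unfolding canonical_def by blast
  obtain Y' where Y': "(Y', Y') \<in> E" "Code Y' U'" "\<And>Z W. (Y', Z) \<in> E \<Longrightarrow> Code Z W \<Longrightarrow> \<not> set_less W U'"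
    using assms(2) unfolding canonical_def by blast
  have "(Y, X) \<in> E" "(Y', X') \<in> E"
    using code_determines_class Y(1,2) Y'(1,2) V assms(3,4) E_carrier by blast+
  then have "(Y, Y') \<in> E" using assms(5) E_sym E_trans by blast
  then have "\<not> set_less U U'" "\<not> set_less U' U"
    using Y(2,3) Y'(2,3) E_sym by blast+
  moreover have "finite U" "finite U'" using assms(3,4) by (simp_all add: code_def)
  ultimately show ?thesis using set_less_total by blast
qed

lemma isomorphic_quotient:
  assumes cong: "congruence \<tau> A E" and univA: "universe A = V"
    and interpA: "\<And>R. R \<in> symbols \<tau> \<Longrightarrow> interp A R \<subseteq> tuples (arity \<tau> R) V"
    and univB: "universe B = {U. canonical T E tp U}"
    and interpB: "\<And>R Us. R \<in> symbols \<tau> \<Longrightarrow> Us \<in> tuples (arity \<tau> R) {U. canonical T E tp U} \<Longrightarrow>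
      Us \<in> interp B R \<longleftrightarrow> (\<exists>Xs\<in>interp A R. list_all2 Code Xs Us)"
  shows "isomorphic \<tau> B (quotient_struct A E)"
proof -
  \<comment> \<open>All sets with code \<open>U\<close> are equivalent, so this union of classes is
    a single class; forming the union avoids choosing a representative.\<close>
  define f where "f = (\<lambda>U. E `` {X \<in> V. Code X U})"
  have f: "f U = E `` {X}" if "X \<in> V" "Code X U" for X U
  proof -
    have "E `` {Y} = E `` {X}" if "Y \<in> V" "Code Y U" for Y
      using code_determines_class[OF that \<open>X \<in> V\<close> \<open>Code X U\<close>] equiv by (rule equiv_class_eq[rotated])
    then show ?thesis using that unfolding f_def by blast
  qed
  have can: "\<exists>X\<in>V. Code X U" if "canonical T E tp U" for U
    using that E_carrier unfolding canonical_def by blast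
  have "bij_betw f {U. canonical T E tp U} (V // E)"
    unfolding bij_betw_def
  proof
    show "inj_on f {U. canonical T E tp U}"
    proof (rule inj_onI, clarify)
      fix U U' assume *: "canonical T E tp U" "canonical T E tp U'" "f U = f U'"
      then obtain X X' where X: "X \<in> V" "Code X U" "X' \<in> V" "Code X' U'" using can by meson
      then have "E `` {X} = E `` {X'}" using f * by simp
      then have "(X, X') \<in> E" using eq_equiv_class[OF _ equiv X(3)] by blast
      then show "U = U'" using canonical_code_unique *(1,2) X by blast
    qed
    show "f ` {U. canonical T E tp U} = V // E"
    proof
      show "f ` {U. canonical T E tp U} \<subseteq> V // E"
        using can f by (force intro: quotientI)
      show "V // E \<subseteq> f ` {U. canonical T E tp U}"
      proof
        fix C assume "C \<in> V // E"
        then obtain X where X: "X \<in> V" "C = E `` {X}" by (rule quotientE)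
        obtain U X' where U: "canonical T E tp U" "(X, X') \<in> E" "Code X' U"
          using canonical_code_exists[OF X(1)] by blast
        then have "f U = C" using f[of X' U] E_carrier X(2) equiv_class_eq[OF equiv U(2)] by simp
        then show "C \<in> f ` {U. canonical T E tp U}" using U(1) by blast
      qed
    qed
  qed
  moreover have "Us \<in> interp B R \<longleftrightarrow> map f Us \<in> map (\<lambda>X. E `` {X}) ` interp A R"
    if R: "R \<in> symbols \<tau>" and Us: "Us \<in> tuples (arity \<tau> R) {U. canonical T E tp U}" for R Us
  proof
    assume "Us \<in> interp B R"
    then obtain Xs where Xs: "Xs \<in> interp A R" "list_all2 Code Xs Us" using interpB[OF R Us] by blast
    have "set Xs \<subseteq> V" using interpA[OF R] Xs(1) by (auto simp: tuples_def)
    then have "f (Us ! i) = E `` {Xs ! i}" if "i < length Us" for i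
      using f that Xs(2) by (simp add: list_all2_conv_all_nth subset_iff)
    then have "map f Us = map (\<lambda>X. E `` {X}) Xs"
      using list_all2_lengthD[OF Xs(2)] by (intro nth_equalityI) simp_all
    then show "map f Us \<in> map (\<lambda>X. E `` {X}) ` interp A R" using Xs(1) by simp
  next
    assume "map f Us \<in> map (\<lambda>X. E `` {X}) ` interp A R"
    then obtain Xs where Xs: "Xs \<in> interp A R" "map f Us = map (\<lambda>X. E `` {X}) Xs" by blast
    have len: "length Us = length Xs" using Xs(2) by (metis length_map)
    have XsV: "Xs \<in> tuples (arity \<tau> R) V" using interpA[OF R] Xs(1) by blast
    \<comment> \<open>The entries of \<open>Xs\<close> need not have the codes \<open>Us\<close>,
      since equivalent sets may have different codes. Sets \<open>Ys\<close> that do have them are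
      chosen, and the congruence property carries \<open>R\<close> over from
      \<open>Xs\<close>.\<close>
    have "\<exists>Y. Y \<in> V \<and> Code Y (Us ! i)" if "i < length Us" for i
    proof -
      have "canonical T E tp (Us ! i)" using Us nth_mem[OF that] by (auto simp: tuples_def)
      then show ?thesis using can by blast
    qed
    then obtain Y where Y: "\<And>i. i < length Us \<Longrightarrow> Y i \<in> V \<and> Code (Y i) (Us ! i)" by metis
    define Ys where "Ys = map Y [0..<length Us]"
    have Ys: "Ys \<in> tuples (arity \<tau> R) V" using Us Y by (auto simp: tuples_def Ys_def)
    have "(Xs ! i, Y i) \<in> E" if i: "i < length Us" for i
    proof -
      have "f (Us ! i) = E `` {Xs ! i}" using arg_cong[OF Xs(2), of "\<lambda>l. l ! i"] i len by simp
      then have "E `` {Xs ! i} = E `` {Y i}" using f[of "Y i" "Us ! i"] Y[OF i] by simp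
      then show ?thesis using eq_equiv_class[OF _ equiv] Y[OF i] by blast
    qed
    then have "list_all2 (\<lambda>x y. (x, y) \<in> E) Xs Ys"
      using len by (auto simp: list_all2_conv_all_nth Ys_def)
    then have "Ys \<in> interp A R"
      using cong R XsV Ys Xs(1) unfolding congruence_def univA by blast
    moreover have "list_all2 Code Ys Us" using Y by (auto simp: list_all2_conv_all_nth Ys_def)
    ultimately show "Us \<in> interp B R" using interpB[OF R Us] by blast
  qed
  ultimately show ?thesis
    unfolding isomorphic_def quotient_struct_def by (intro exI[of _ f]) (simp add: univA univB)
qed

end

section \<open>Definability of codes\<close>

text \<open>Reduces the lexicographic order to prefixes and successors, which formulas can express:
  incomparable words part at a node \<open>u\<close> into its two children.\<close>

lemma bool_list_less_iff:
  "xs < ys \<longleftrightarrow> strict_prefix xs ys \<or> (\<exists>u. prefix (u @ [False]) xs \<and> prefix (u @ [True]) ys)"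
  for xs ys :: "bool list"
proof -
  have "xs < ys \<longleftrightarrow> (\<exists>a v. ys = xs @ a # v) \<or>
      (\<exists>u a b v w. a < b \<and> xs = u @ a # v \<and> ys = u @ b # w)"
    by (simp add: list_less_def lexord_def)
  also have "\<dots> \<longleftrightarrow> (\<exists>a v. ys = xs @ a # v) \<or> (\<exists>u v w. xs = u @ False # v \<and> ys = u @ True # w)"
    by (metis less_bool_def)
  finally have "xs < ys \<longleftrightarrow> (\<exists>a v. ys = xs @ a # v) \<or>
      (\<exists>u v w. xs = u @ False # v \<and> ys = u @ True # w)" .
  moreover have "strict_prefix xs ys \<longleftrightarrow> (\<exists>a v. ys = xs @ a # v)"
    by (blast elim: strict_prefixE' intro: strict_prefixI')
  ultimately show ?thesis by (auto simp: prefix_def)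
qed

lemma definable_less: "definable \<Sigma> (\<lambda>t e s. e i < e j)"
proof (rule definable_cong)
  show "definable \<Sigma> (\<lambda>t e s. prefix (e i) (e j) \<and> e i \<noteq> e j \<or>
      (\<exists>u\<in>dom t. \<exists>p\<in>dom t. \<exists>q\<in>dom t. p = u @ [False] \<and> q = u @ [True] \<and>
        prefix p (e i) \<and> prefix q (e j)))"
    by (intro definable_intros definable_prefix)
  fix t :: "'a tree" and e s
  assume t: "is_tree \<Sigma> t" and val: "valuation t e s"
  \<comment> \<open>The fork and its children are prefixes of nodes of the tree, so bounding the
    quantifiers by the tree loses nothing.\<close>
  have dom: "u \<in> dom t" "u @ [False] \<in> dom t" "u @ [True] \<in> dom t"
    if "prefix (u @ [False]) (e i)" "prefix (u @ [True]) (e j)" for u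
  proof -
    have "e i \<in> dom t" "e j \<in> dom t" using val by (simp_all add: valuation_def)
    then show "u @ [False] \<in> dom t" "u @ [True] \<in> dom t" using is_tree_prefix[OF t] that by blast+
    then show "u \<in> dom t" using is_tree_prefix[OF t] prefixI by blast
  qed
  have "(\<exists>u. prefix (u @ [False]) (e i) \<and> prefix (u @ [True]) (e j)) \<longleftrightarrow>
      (\<exists>u\<in>dom t. \<exists>p\<in>dom t. \<exists>q\<in>dom t. p = u @ [False] \<and> q = u @ [True] \<and>
        prefix p (e i) \<and> prefix q (e j))" (is "?L \<longleftrightarrow> ?R")
  proof
    assume ?L
    then obtain u where u: "prefix (u @ [False]) (e i)" "prefix (u @ [True]) (e j)" by blast
    show ?R
      by (rule bexI[OF _ dom(1)[OF u]], rule bexI[OF _ dom(2)[OF u]], rule bexI[OF _ dom(3)[OF u]])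
        (use u in simp)
  next
    assume ?R
    then show ?L by (elim bexE conjE) (simp only:, blast)
  qed
  then show "e i < e j \<longleftrightarrow> prefix (e i) (e j) \<and> e i \<noteq> e j \<or>
      (\<exists>u\<in>dom t. \<exists>p\<in>dom t. \<exists>q\<in>dom t. p = u @ [False] \<and> q = u @ [True] \<and>
        prefix p (e i) \<and> prefix q (e j))"
    unfolding bool_list_less_iff strict_prefix_def by (simp only:)
qed

lemma definable_set_less: "definable \<Sigma> (\<lambda>t e s. set_less (s i) (s j))"
proof (rule definable_cong)
  show "definable \<Sigma> (\<lambda>t e s. \<exists>x\<in>dom t. x \<in> s i \<and> x \<notin> s j \<and>
      (\<forall>y\<in>dom t. y < x \<longrightarrow> (y \<in> s i \<longleftrightarrow> y \<in> s j)))"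
    by (intro definable_intros definable_less)
  show "set_less (s i) (s j) \<longleftrightarrow> (\<exists>x\<in>dom t. x \<in> s i \<and> x \<notin> s j \<and>
      (\<forall>y\<in>dom t. y < x \<longrightarrow> (y \<in> s i \<longleftrightarrow> y \<in> s j)))"
    if "valuation t e s" for t :: "'a tree" and e s
  proof -
    have "s i \<subseteq> dom t" "s j \<subseteq> dom t" using that by (simp_all add: valuation_def)
    then show ?thesis unfolding set_less_def by blast
  qed
qed

text \<open>Infinity is expressible with finite sets alone: no finite set exhausts the
  subtree.\<close>

lemma definable_big: "definable \<Sigma> (\<lambda>t e s. big (dom t) (e i))"
proof (rule definable_cong)
  show "definable \<Sigma> (\<lambda>t e s. \<forall>Z. finite Z \<longrightarrow> Z \<subseteq> dom t \<longrightarrow> (\<exists>v\<in>dom t. prefix (e i) v \<and> v \<notin> Z))"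
    by (intro definable_intros definable_prefix)
  fix t :: "'a tree" and e :: "nat \<Rightarrow> bool list" and s :: "nat \<Rightarrow> bool list set"
  assume "valuation t e s"
  then have "e i \<in> dom t" by (simp add: valuation_def)
  show "big (dom t) (e i) \<longleftrightarrow> (\<forall>Z. finite Z \<longrightarrow> Z \<subseteq> dom t \<longrightarrow> (\<exists>v\<in>dom t. prefix (e i) v \<and> v \<notin> Z))"
  proof
    assume "big (dom t) (e i)"
    then have inf: "infinite (subtree (dom t) (e i))" by (simp add: big_def)
    show "\<forall>Z. finite Z \<longrightarrow> Z \<subseteq> dom t \<longrightarrow> (\<exists>v\<in>dom t. prefix (e i) v \<and> v \<notin> Z)"
    proof (intro allI impI)
      fix Z :: "bool list set" assume "finite Z"
      with inf have "\<not> subtree (dom t) (e i) \<subseteq> Z" using finite_subset by blast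
      then show "\<exists>v\<in>dom t. prefix (e i) v \<and> v \<notin> Z" unfolding subset_iff in_subtree by blast
    qed
  next
    assume *: "\<forall>Z. finite Z \<longrightarrow> Z \<subseteq> dom t \<longrightarrow> (\<exists>v\<in>dom t. prefix (e i) v \<and> v \<notin> Z)"
    have sub: "subtree (dom t) (e i) \<subseteq> dom t" unfolding subset_iff in_subtree by blast
    have "infinite (subtree (dom t) (e i))"
    proof
      assume "finite (subtree (dom t) (e i))"
      from *[rule_format, OF this sub] show False unfolding in_subtree by blast
    qed
    with \<open>e i \<in> dom t\<close> show "big (dom t) (e i)" by (simp add: big_def)
  qed
qed

lemma prefix_nxt_pow: "prefix u ((nxt T ^^ n) u)"
proof (induction n)
  case (Suc n)
  have "prefix v (nxt T v)" for v by (simp add: nxt_def)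
  with Suc show ?case by (simp add: prefix_order.trans)
qed simp

lemma definable_nxt: "definable \<Sigma> (\<lambda>t e s. e j = nxt (dom t) (e i))"
proof (rule definable_cong)
  show "definable \<Sigma> (\<lambda>t e s.
      (\<exists>v\<in>dom t. v = e i @ [False] \<and> big (dom t) v) \<and> e j = e i @ [False] \<or>
      \<not> (\<exists>v\<in>dom t. v = e i @ [False] \<and> big (dom t) v) \<and> e j = e i @ [True])"
    by (intro definable_intros definable_big)
  have "big (dom t) (e i @ [False]) \<longleftrightarrow> (\<exists>v\<in>dom t. v = e i @ [False] \<and> big (dom t) v)"
    for t :: "'a tree" and e
    by (auto simp: big_def)
  then show "e j = nxt (dom t) (e i) \<longleftrightarrow>
      (\<exists>v\<in>dom t. v = e i @ [False] \<and> big (dom t) v) \<and> e j = e i @ [False] \<or>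
      \<not> (\<exists>v\<in>dom t. v = e i @ [False] \<and> big (dom t) v) \<and> e j = e i @ [True]"
    for t :: "'a tree" and e s
    unfolding nxt_def by presburger
qed

text \<open>The exponent is external to the logic, so there is one formula for each
  \<open>n\<close>. Intermediate nodes are prefixes of \<open>e j\<close> and hence lie in the
  tree.\<close>

lemma definable_nxt_pow: "definable \<Sigma> (\<lambda>t e s. e j = (nxt (dom t) ^^ n) (e i))"
proof (induction n arbitrary: i j)
  case 0
  then show ?case by (simp add: definable_eq)
next
  case (Suc n)
  show ?case
  proof (rule definable_cong)
    show "definable \<Sigma> (\<lambda>t e s. \<exists>w\<in>dom t. w = (nxt (dom t) ^^ n) (e i) \<and> e j = nxt (dom t) w)"
      by (intro definable_intros definable_nxt Suc.IH)
    fix t :: "'a tree" and e s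
    assume t: "is_tree \<Sigma> t" and val: "valuation t e s"
    have "(nxt (dom t) ^^ n) (e i) \<in> dom t" if "e j = nxt (dom t) ((nxt (dom t) ^^ n) (e i))"
    proof -
      have "prefix ((nxt (dom t) ^^ n) (e i)) (e j)"
        unfolding that using prefix_nxt_pow[where T = "dom t" and n = 1] by simp
      moreover have "e j \<in> dom t" using val by (simp add: valuation_def)
      ultimately show ?thesis using is_tree_prefix[OF t] by blast
    qed
    then show "e j = (nxt (dom t) ^^ Suc n) (e i) \<longleftrightarrow>
        (\<exists>w\<in>dom t. w = (nxt (dom t) ^^ n) (e i) \<and> e j = nxt (dom t) w)"
      by auto
  qed
qed

lemma subtree_subset: "subtree T u \<subseteq> T"
  by (simp add: subtree_def)

lemma Int_subtree_eq_iff: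
  assumes "{u, w} \<subseteq> T"
  shows "U \<inter> subtree T u = {u, w} \<longleftrightarrow> (\<forall>v\<in>T. v \<in> U \<and> prefix u v \<longleftrightarrow> v = u \<or> v = w)"
  using assms by (auto simp: set_eq_iff)

section \<open>Definability of borders, codes and canonical codes\<close>

context
  fixes \<Sigma> :: "'a set" and E :: "'a tree \<Rightarrow> (bool list set \<times> bool list set) set"
    and tp :: "'a tree \<Rightarrow> bool list \<Rightarrow> bool list set \<Rightarrow> nat" and K :: nat
  assumes E_def: "\<And>i j. definable \<Sigma> (\<lambda>t e s. (s i, s j) \<in> E t)"
    and E_finite: "\<And>t X Y. (X, Y) \<in> E t \<Longrightarrow> finite X \<and> X \<subseteq> dom t \<and> finite Y \<and> Y \<subseteq> dom t"
    and tp_definable: "\<And>i j k. definable \<Sigma> (\<lambda>t e s. tp t (e i) (s j) = k)"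
    and tp_bound: "\<And>t u X. tp t u X < K"
begin

lemma definable_free: "definable \<Sigma> (\<lambda>t e s. free (dom t) (E t) (s j) (e i))"
proof (rule definable_cong)
  show "definable \<Sigma> (\<lambda>t e s. big (dom t) (e i) \<and> (\<exists>Y. finite Y \<and> Y \<subseteq> dom t \<and>
      ((s j, Y) \<in> E t \<and> (\<forall>v\<in>dom t. v \<in> Y \<longrightarrow> \<not> prefix (e i) v))))"
    by (intro definable_intros definable_prefix definable_big E_def)
  have disj: "Y \<inter> subtree (dom t) u = {} \<longleftrightarrow> (\<forall>v\<in>dom t. v \<in> Y \<longrightarrow> \<not> prefix u v)" for t :: "'a tree" and Y u
    unfolding disjoint_iff in_subtree by blast
  \<comment> \<open>Sets related by \<open>E\<close> are finite sets of nodes, so the unrestricted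
    quantifier in \<open>free\<close> agrees with a weak one.\<close>
  have bounded: "(\<exists>Y. (X, Y) \<in> E t \<and> Q Y) \<longleftrightarrow> (\<exists>Y. finite Y \<and> Y \<subseteq> dom t \<and> ((X, Y) \<in> E t \<and> Q Y))"
    for t X Q
    by (metis E_finite)
  show "free (dom t) (E t) (s j) (e i) \<longleftrightarrow> big (dom t) (e i) \<and> (\<exists>Y. finite Y \<and> Y \<subseteq> dom t \<and>
      ((s j, Y) \<in> E t \<and> (\<forall>v\<in>dom t. v \<in> Y \<longrightarrow> \<not> prefix (e i) v)))" for t e s
    by (simp only: free_def disj bounded[of "s j" t])
qed

lemma definable_border: "definable \<Sigma> (\<lambda>t e s. border (dom t) (E t) (s j) (e i))"
  unfolding border_def by (intro definable_intros definable_prefix definable_free)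

text \<open>The depth of a marker varies with the type while each depth has its own formula; the
  bound \<open>K\<close> turns this dependence into a finite disjunction.\<close>

lemma definable_code: "definable \<Sigma> (\<lambda>t e s. code (dom t) (E t) (tp t) (s j) (s k))"
proof (rule definable_cong)
  show "definable \<Sigma> (\<lambda>t e s.
      (\<forall>v\<in>dom t. (\<forall>u\<in>dom t. border (dom t) (E t) (s j) u \<longrightarrow> \<not> prefix u v) \<longrightarrow> (v \<in> s k \<longleftrightarrow> v \<in> s j)) \<and>
      (\<forall>u\<in>dom t. border (dom t) (E t) (s j) u \<longrightarrow> (\<exists>i\<in>{..<K}. tp t u (s j) = i \<and>
        (\<forall>v\<in>dom t. v \<in> s k \<and> prefix u v \<longleftrightarrow> v = u \<or> v = (nxt (dom t) ^^ Suc i) u))))"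
    by (intro definable_intros definable_prefix definable_border definable_bex tp_definable
        definable_nxt_pow) simp
  fix t :: "'a tree" and e s
  assume t: "is_tree \<Sigma> t" and val: "valuation t e s"
  then interpret prefix_closed_set "dom t" by unfold_locales (use is_tree_prefix in blast)
  have fin: "finite (s k)" "s k \<subseteq> dom t" using val by (simp_all add: valuation_def)
  have "s k \<inter> subtree (dom t) u = marker (dom t) u (tp t u (s j)) \<longleftrightarrow>
      (\<exists>i\<in>{..<K}. tp t u (s j) = i \<and>
        (\<forall>v\<in>dom t. v \<in> s k \<and> prefix u v \<longleftrightarrow> v = u \<or> v = (nxt (dom t) ^^ Suc i) u))"
    if "border (dom t) (E t) (s j) u" for u
  proof -
    \<comment> \<open>An infinite subtree has room for every marker, so quantification over nodes of
      the tree sees both of its elements.\<close>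
    have "big (dom t) u" using that by (simp add: border_def free_def)
    then have "marker (dom t) u i \<subseteq> dom t" for i
      by (rule order_trans[OF marker_subset subtree_subset])
    then have "s k \<inter> subtree (dom t) u = marker (dom t) u i \<longleftrightarrow>
        (\<forall>v\<in>dom t. v \<in> s k \<and> prefix u v \<longleftrightarrow> v = u \<or> v = (nxt (dom t) ^^ Suc i) u)" for i
      unfolding marker_def by (rule Int_subtree_eq_iff)
    moreover have "(\<exists>i\<in>{..<K}. tp t u (s j) = i \<and> Q i) \<longleftrightarrow> Q (tp t u (s j))" for Q
      using tp_bound by auto
    ultimately show ?thesis by (simp only:)
  qed
  then have "(\<forall>u\<in>dom t. border (dom t) (E t) (s j) u \<longrightarrow>
        s k \<inter> subtree (dom t) u = marker (dom t) u (tp t u (s j))) \<longleftrightarrow>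
      (\<forall>u\<in>dom t. border (dom t) (E t) (s j) u \<longrightarrow> (\<exists>i\<in>{..<K}. tp t u (s j) = i \<and>
        (\<forall>v\<in>dom t. v \<in> s k \<and> prefix u v \<longleftrightarrow> v = u \<or> v = (nxt (dom t) ^^ Suc i) u)))"
    by (intro ball_cong imp_cong refl)
  then show "code (dom t) (E t) (tp t) (s j) (s k) \<longleftrightarrow>
      (\<forall>v\<in>dom t. (\<forall>u\<in>dom t. border (dom t) (E t) (s j) u \<longrightarrow> \<not> prefix u v) \<longrightarrow> (v \<in> s k \<longleftrightarrow> v \<in> s j)) \<and>
      (\<forall>u\<in>dom t. border (dom t) (E t) (s j) u \<longrightarrow> (\<exists>i\<in>{..<K}. tp t u (s j) = i \<and>
        (\<forall>v\<in>dom t. v \<in> s k \<and> prefix u v \<longleftrightarrow> v = u \<or> v = (nxt (dom t) ^^ Suc i) u)))"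
    unfolding code_def using fin by (simp only: simp_thms)
qed

lemma definable_canonical: "definable \<Sigma> (\<lambda>t e s. canonical (dom t) (E t) (tp t) (s k))"
proof (rule definable_cong)
  show "definable \<Sigma> (\<lambda>t e s. \<exists>X. finite X \<and> X \<subseteq> dom t \<and> ((X, X) \<in> E t \<and>
      code (dom t) (E t) (tp t) X (s k) \<and>
      (\<forall>X'. finite X' \<longrightarrow> X' \<subseteq> dom t \<longrightarrow> (\<forall>U'. finite U' \<longrightarrow> U' \<subseteq> dom t \<longrightarrow>
        (X, X') \<in> E t \<longrightarrow> code (dom t) (E t) (tp t) X' U' \<longrightarrow> \<not> set_less U' (s k)))))"
    by (intro definable_intros definable_code definable_set_less E_def)
  have code_finite: "finite U \<and> U \<subseteq> dom t" if "code (dom t) (E t) (tp t) X U" for t X U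
    using that by (simp add: code_def)
  have ex_bounded: "(\<exists>X. (X, X) \<in> E t \<and> Q X) \<longleftrightarrow>
      (\<exists>X. finite X \<and> X \<subseteq> dom t \<and> ((X, X) \<in> E t \<and> Q X))" for t Q
    by (metis E_finite)
  have all_bounded: "(\<forall>X' U'. (X, X') \<in> E t \<longrightarrow> code (dom t) (E t) (tp t) X' U' \<longrightarrow> Q U') \<longleftrightarrow>
      (\<forall>X'. finite X' \<longrightarrow> X' \<subseteq> dom t \<longrightarrow> (\<forall>U'. finite U' \<longrightarrow> U' \<subseteq> dom t \<longrightarrow>
        (X, X') \<in> E t \<longrightarrow> code (dom t) (E t) (tp t) X' U' \<longrightarrow> Q U'))" for t X Q
    by (metis E_finite code_finite)
  show "canonical (dom t) (E t) (tp t) (s k) \<longleftrightarrow> (\<exists>X. finite X \<and> X \<subseteq> dom t \<and> ((X, X) \<in> E t \<and>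
      code (dom t) (E t) (tp t) X (s k) \<and>
      (\<forall>X'. finite X' \<longrightarrow> X' \<subseteq> dom t \<longrightarrow> (\<forall>U'. finite U' \<longrightarrow> U' \<subseteq> dom t \<longrightarrow>
        (X, X') \<in> E t \<longrightarrow> code (dom t) (E t) (tp t) X' U' \<longrightarrow> \<not> set_less U' (s k)))))" for t e s
    unfolding canonical_def all_bounded by (rule ex_bounded)
qed

end

section \<open>The interpretation of the quotient\<close>

lemma definable_fs_universe:
  assumes "set_formula (tree_signature \<Sigma>) 1 (dom_formula I)"
  shows "definable \<Sigma> (\<lambda>t e s. s i \<in> fs_universe I (tree_struct t))"
proof (rule definable_cong)
  show "definable \<Sigma> (\<lambda>t e s. holds (tree_struct t) (map s [i]) (dom_formula I))"
    using assms by (intro definable_holds) simp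
  show "s i \<in> fs_universe I (tree_struct t) \<longleftrightarrow> holds (tree_struct t) (map s [i]) (dom_formula I)"
    if "valuation t e s" for t :: "'a tree" and e s
    using that by (auto simp: fs_universe_def valuation_def)
qed

lemma binary_rel_apply_interp:
  assumes "arity \<tau> R = 2"
  shows "(X, Y) \<in> binary_rel (apply_interp \<tau> I A) R \<longleftrightarrow>
    X \<in> fs_universe I A \<and> Y \<in> fs_universe I A \<and> holds A [X, Y] (rel_formula I R)"
  using assms by (auto simp: binary_rel_def apply_interp_def tuples_def)

text \<open>Used to lift a relation from sets to codes. The first \<open>n\<close> set variables are
  the codes; the next \<open>n\<close>, disjoint from them, are quantified as a block and hold the
  tuple of coded sets.\<close>

lemma definable_image_tuples:
  assumes dom: "\<And>i. definable \<Sigma> (\<lambda>t e s. s i \<in> fs_universe I (tree_struct t))"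
    and rel: "set_formula (tree_signature \<Sigma>) n (rel_formula I R)" and n: "arity \<tau> R = n"
    and C: "\<And>i j. definable \<Sigma> (\<lambda>t e s. C t (s i) (s j))"
  shows "definable \<Sigma> (\<lambda>t e s. \<exists>Xs\<in>interp (apply_interp \<tau> I (tree_struct t)) R.
    list_all2 (C t) Xs (map s [0..<n]))"
proof (rule definable_cong)
  let ?Q = "\<lambda>t e s. (\<forall>i\<in>{..<n}. C t (s (n + i)) (s i)) \<and>
      (\<forall>i\<in>{..<n}. s (n + i) \<in> fs_universe I (tree_struct t)) \<and>
      holds (tree_struct t) (map s [n..<2 * n]) (rel_formula I R)"
  have "definable \<Sigma> ?Q"
    using rel by (intro definable_conj definable_ball definable_holds C dom) simp_all
  then show "definable \<Sigma> (\<lambda>t e s. \<exists>s'. valuation t e s' \<and> (\<forall>i. i \<notin> {n..<2 * n} \<longrightarrow> s' i = s i) \<and> ?Q t e s')"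
    by (intro definable_ex_sets_named) simp_all
  fix t :: "'a tree" and e s
  assume val: "valuation t e s"
  show "(\<exists>Xs\<in>interp (apply_interp \<tau> I (tree_struct t)) R. list_all2 (C t) Xs (map s [0..<n])) \<longleftrightarrow>
      (\<exists>s'. valuation t e s' \<and> (\<forall>i. i \<notin> {n..<2 * n} \<longrightarrow> s' i = s i) \<and> ?Q t e s')" (is "?L \<longleftrightarrow> ?R")
  proof
    assume ?L
    then obtain Xs where Xs: "length Xs = n" "set Xs \<subseteq> fs_universe I (tree_struct t)"
      "holds (tree_struct t) Xs (rel_formula I R)" "list_all2 (C t) Xs (map s [0..<n])"
      by (auto simp: apply_interp_def tuples_def n)
    define s' where "s' = (\<lambda>i. if i \<in> {n..<2 * n} then Xs ! (i - n) else s i)"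
    have Xs_s': "map s' [n..<2 * n] = Xs"
      using Xs(1) by (intro nth_equalityI) (auto simp: s'_def)
    have nth: "Xs ! i \<in> fs_universe I (tree_struct t)" if "i < n" for i
      using that Xs(1,2) nth_mem by blast
    have "finite (s' i) \<and> s' i \<subseteq> dom t" for i
    proof (cases "i \<in> {n..<2 * n}")
      case True
      then have "i - n < n" by auto
      from nth[OF this] True show ?thesis by (simp add: s'_def fs_universe_def)
    next
      case False
      then show ?thesis using val unfolding s'_def valuation_def by (simp only: if_False)
    qed
    then have "valuation t e s'" using val by (simp add: valuation_def)
    moreover have "\<forall>i. i \<notin> {n..<2 * n} \<longrightarrow> s' i = s i" by (simp add: s'_def)
    moreover have "\<forall>i\<in>{..<n}. C t (s' (n + i)) (s' i)"
      using Xs(1) list_all2_nthD[OF Xs(4)] by (simp add: s'_def)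
    moreover have "\<forall>i\<in>{..<n}. s' (n + i) \<in> fs_universe I (tree_struct t)"
      using nth by (simp add: s'_def)
    ultimately show ?R using Xs(3) Xs_s' by metis
  next
    assume ?R
    then obtain s' where s': "\<forall>i. i \<notin> {n..<2 * n} \<longrightarrow> s' i = s i" "?Q t e s'" by blast
    let ?Xs = "map s' [n..<2 * n]"
    have nth: "?Xs ! i = s' (n + i)" if "i < n" for i using that by simp
    have "list_all2 (C t) ?Xs (map s [0..<n])"
      using s' nth by (simp add: list_all2_conv_all_nth)
    moreover have "s' i \<in> fs_universe I (tree_struct t)" if "i \<in> {n..<2 * n}" for i
    proof -
      have "i - n < n" "n + (i - n) = i" using that by auto
      then show ?thesis using s'(2) by (metis lessThan_iff)
    qed
    then have "set ?Xs \<subseteq> fs_universe I (tree_struct t)" by auto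
    then have "?Xs \<in> interp (apply_interp \<tau> I (tree_struct t)) R"
      using s'(2) by (simp add: apply_interp_def tuples_def n)
    ultimately show ?L by blast
  qed
qed

theorem theorem4p1:
  fixes \<Sigma> :: "'a set"
    and \<tau> :: "'r signature"
    and I :: "('a tree_sym, 'r) fs_interp"
    and sim :: 'r
  assumes "finite \<Sigma>"
    and "finite_sets_interpretation (tree_signature \<Sigma>) \<tau> I"
    and "sim \<in> symbols \<tau>" and "arity \<tau> sim = 2"
  shows "\<exists>I' :: ('a tree_sym, 'r) fs_interp.
    finite_sets_interpretation (tree_signature \<Sigma>) \<tau> I' \<and>
    (\<forall>t :: 'a tree. is_tree \<Sigma> t \<longrightarrow>
       congruence \<tau> (apply_interp \<tau> I (tree_struct t))
         (binary_rel (apply_interp \<tau> I (tree_struct t)) sim) \<longrightarrow>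
       isomorphic \<tau> (apply_interp \<tau> I' (tree_struct t))
         (quotient_struct (apply_interp \<tau> I (tree_struct t))
           (binary_rel (apply_interp \<tau> I (tree_struct t)) sim)))"
proof -
  let ?A = "\<lambda>t :: 'a tree. apply_interp \<tau> I (tree_struct t)"
  let ?V = "\<lambda>t :: 'a tree. fs_universe I (tree_struct t)"
  define E where "E = (\<lambda>t. binary_rel (?A t) sim)"
  have fin: "finite (symbols \<tau>)" and dom: "set_formula (tree_signature \<Sigma>) 1 (dom_formula I)"
    and rel: "\<And>R. R \<in> symbols \<tau> \<Longrightarrow> set_formula (tree_signature \<Sigma>) (arity \<tau> R) (rel_formula I R)"
    using assms(2) by (auto simp: finite_sets_interpretation_def)
  note V_def = definable_fs_universe[OF dom]
  have E: "(X, Y) \<in> E t \<longleftrightarrow> X \<in> ?V t \<and> Y \<in> ?V t \<and> holds (tree_struct t) [X, Y] (rel_formula I sim)"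
    for X Y t
    unfolding E_def using assms(4) by (rule binary_rel_apply_interp)
  have V_finite: "X \<in> ?V t \<Longrightarrow> finite X \<and> X \<subseteq> dom t" for X t
    by (simp add: fs_universe_def)
  have E_definable: "definable \<Sigma> (\<lambda>t e s. (s i, s j) \<in> E t)" for i j
  proof -
    have "definable \<Sigma> (\<lambda>t e s. holds (tree_struct t) (map s [i, j]) (rel_formula I sim))"
      using rel[OF assms(3)] assms(4) by (intro definable_holds) (simp add: numeral_2_eq_2)
    then have "definable \<Sigma> (\<lambda>t e s. holds (tree_struct t) [s i, s j] (rel_formula I sim))" by simp
    then show ?thesis unfolding E by (intro definable_conj V_def)
  qed
  have E_finite: "finite X \<and> X \<subseteq> dom t \<and> finite Y \<and> Y \<subseteq> dom t" if "(X, Y) \<in> E t" for t X Y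
    using that V_finite[of X t] V_finite[of Y t] by (simp add: E)
  obtain K tp where tp_bound: "\<And>t u X. tp t u X < (K :: nat)"
    and tp_definable: "\<And>i j k. definable \<Sigma> (\<lambda>t e s. tp t (e i) (s j) = k)"
    and tp_local: "\<And>t u X X'. X \<inter> subtree (dom t) u = X' \<inter> subtree (dom t) u \<Longrightarrow> tp t u X = tp t u X'"
    and tp_swap: "\<And>t u X X' Y. is_tree \<Sigma> t \<Longrightarrow> u \<in> dom t \<Longrightarrow> finite X \<Longrightarrow> X \<subseteq> dom t \<Longrightarrow>
      finite X' \<Longrightarrow> X' \<subseteq> dom t \<Longrightarrow> finite Y \<Longrightarrow> Y \<subseteq> dom t \<Longrightarrow>
      X - subtree (dom t) u = X' - subtree (dom t) u \<Longrightarrow> tp t u X = tp t u X' \<Longrightarrow>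
      Y \<inter> subtree (dom t) u = {} \<Longrightarrow> (X, Y) \<in> E t \<Longrightarrow> (X', Y) \<in> E t"
  proof (rule finitely_many_subtree_types[of \<Sigma> "\<lambda>t X Y. (X, Y) \<in> E t", OF E_definable], goal_cases)
    case (1 K tp)
    show ?case by (rule that) (fact 1)+
  qed
  let ?C = "\<lambda>t. code (dom t) (E t) (tp t)" and ?can = "\<lambda>t. canonical (dom t) (E t) (tp t)"
  have code_definable: "definable \<Sigma> (\<lambda>t e s. ?C t (s i) (s j))" for i j
    by (rule definable_code) (fact E_definable E_finite tp_definable tp_bound)+
  have can_definable: "definable \<Sigma> (\<lambda>t e s. ?can t (s i))" for i
    by (rule definable_canonical) (fact E_definable E_finite tp_definable tp_bound)+
  have "definable \<Sigma> (\<lambda>t e s. ?can t (hd (map s [0..<1])))"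
    using can_definable[of 0] by simp
  then obtain \<delta> where \<delta>: "set_formula (tree_signature \<Sigma>) 1 \<delta>"
    "\<And>t Us. is_tree \<Sigma> t \<Longrightarrow> length Us = 1 \<Longrightarrow> (\<And>U. U \<in> set Us \<Longrightarrow> finite U \<and> U \<subseteq> dom t) \<Longrightarrow>
       holds (tree_struct t) Us \<delta> \<longleftrightarrow> ?can t (hd Us)"
  proof (rule definable_set_formula[where P = "\<lambda>t Us. ?can t (hd Us)"], goal_cases)
    case (1 \<delta>)
    show ?case by (rule that) (fact 1)+
  qed
  have "\<exists>\<psi>. set_formula (tree_signature \<Sigma>) (arity \<tau> R) \<psi> \<and>
      (\<forall>t Us. is_tree \<Sigma> t \<longrightarrow> length Us = arity \<tau> R \<longrightarrow> (\<forall>U\<in>set Us. finite U \<and> U \<subseteq> dom t) \<longrightarrow>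
        (holds (tree_struct t) Us \<psi> \<longleftrightarrow> (\<exists>Xs\<in>interp (?A t) R. list_all2 (?C t) Xs Us)))"
    if R: "R \<in> symbols \<tau>" for R
  proof -
    obtain \<psi> where \<psi>: "set_formula (tree_signature \<Sigma>) (arity \<tau> R) \<psi>"
      "\<And>t Us. is_tree \<Sigma> t \<Longrightarrow> length Us = arity \<tau> R \<Longrightarrow> (\<And>U. U \<in> set Us \<Longrightarrow> finite U \<and> U \<subseteq> dom t) \<Longrightarrow>
        holds (tree_struct t) Us \<psi> \<longleftrightarrow> (\<exists>Xs\<in>interp (?A t) R. list_all2 (?C t) Xs Us)"
      using definable_image_tuples[where C = ?C and \<tau> = \<tau>, OF V_def rel[OF R] refl code_definable]
    proof (rule definable_set_formula[where
            P = "\<lambda>t Us. \<exists>Xs\<in>interp (?A t) R. list_all2 (?C t) Xs Us"], goal_cases)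
      case (1 \<psi>)
      show ?case by (rule that) (fact 1)+
    qed
    show ?thesis
      by (rule exI[of _ \<psi>], rule conjI, rule \<psi>(1), intro allI impI, rule \<psi>(2))
        (assumption | erule bspec)+
  qed
  then obtain \<psi> where \<psi>: "\<And>R. R \<in> symbols \<tau> \<Longrightarrow> set_formula (tree_signature \<Sigma>) (arity \<tau> R) (\<psi> R)"
    "\<And>R t Us. R \<in> symbols \<tau> \<Longrightarrow> is_tree \<Sigma> t \<Longrightarrow> length Us = arity \<tau> R \<Longrightarrow>
       \<forall>U\<in>set Us. finite U \<and> U \<subseteq> dom t \<Longrightarrow>
       holds (tree_struct t) Us (\<psi> R) \<longleftrightarrow> (\<exists>Xs\<in>interp (?A t) R. list_all2 (?C t) Xs Us)"
    by metis
  define I' where "I' = \<lparr>dom_formula = \<delta>, rel_formula = \<psi>\<rparr>"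
  have "finite_sets_interpretation (tree_signature \<Sigma>) \<tau> I'"
    using fin \<delta>(1) \<psi>(1) by (simp add: finite_sets_interpretation_def I'_def)
  moreover have "isomorphic \<tau> (apply_interp \<tau> I' (tree_struct t)) (quotient_struct (?A t) (E t))"
    if t: "is_tree \<Sigma> t" and cong: "congruence \<tau> (?A t) (E t)" for t
  proof -
    have univ: "universe (?A t) = ?V t" by (simp add: apply_interp_def)
    \<comment> \<open>Only here is \<open>E t\<close> required to be an equivalence: the formulas
      were built for all trees, and their meaning matters only for trees on which \<open>sim\<close>
      is a congruence.\<close>
    interpret class_coding "dom t" "?V t" "E t" "tp t" K
    proof
      show "u \<in> dom t" if "v \<in> dom t" "prefix u v" for u v using is_tree_prefix[OF t that] .
      show "equiv (?V t) (E t)" using cong by (simp add: congruence_def univ)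
      show "finite X \<and> X \<subseteq> dom t" if "X \<in> ?V t" for X using V_finite that .
      show "tp t u X < K" for u X by (rule tp_bound)
      show "tp t u X = tp t u X'" if "X \<inter> subtree (dom t) u = X' \<inter> subtree (dom t) u" for X u X'
        using that by (rule tp_local)
      show "(X', Y) \<in> E t"
        if "u \<in> dom t" "finite X" "X \<subseteq> dom t" "finite X'" "X' \<subseteq> dom t" "finite Y" "Y \<subseteq> dom t"
          "X - subtree (dom t) u = X' - subtree (dom t) u" "tp t u X = tp t u X'"
          "Y \<inter> subtree (dom t) u = {}" "(X, Y) \<in> E t" for u X X' Y
        using t that by (rule tp_swap)
    qed
    have can_finite: "finite U \<and> U \<subseteq> dom t" if can: "?can t U" for U
    proof -
      obtain X where "?C t X U" using can unfolding canonical_def by blast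
      then show ?thesis by (simp add: code_def)
    qed
    \<comment> \<open>The formula \<open>\<delta>\<close> is correct on finite sets of nodes, and
      every canonical code is such a set.\<close>
    have "holds (tree_struct t) [U] \<delta> \<longleftrightarrow> ?can t U" if "finite U" "U \<subseteq> dom t" for U
      using \<delta>(2)[OF t, of "[U]"] that by simp
    then have "finite U \<and> U \<subseteq> dom t \<and> holds (tree_struct t) [U] \<delta> \<longleftrightarrow> ?can t U" for U
      using can_finite[of U] by metis
    then have univ': "fs_universe I' (tree_struct t) = {U. ?can t U}"
      by (simp add: fs_universe_def I'_def)
    show ?thesis
    proof (rule isomorphic_quotient[OF cong univ])
      show "interp (?A t) R \<subseteq> tuples (arity \<tau> R) (?V t)" for R
        by (auto simp: apply_interp_def)
      show "universe (apply_interp \<tau> I' (tree_struct t)) = {U. ?can t U}"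
        by (simp add: apply_interp_def univ')
      show "Us \<in> interp (apply_interp \<tau> I' (tree_struct t)) R \<longleftrightarrow>
          (\<exists>Xs\<in>interp (?A t) R. list_all2 (?C t) Xs Us)"
        if R: "R \<in> symbols \<tau>" and Us: "Us \<in> tuples (arity \<tau> R) {U. ?can t U}" for R Us
      proof -
        have "length Us = arity \<tau> R" "\<forall>U\<in>set Us. finite U \<and> U \<subseteq> dom t"
          using Us can_finite by (auto simp: tuples_def)
        from \<psi>(2)[OF R t this]
        have "holds (tree_struct t) Us (\<psi> R) \<longleftrightarrow> (\<exists>Xs\<in>interp (?A t) R. list_all2 (?C t) Xs Us)" .
        moreover have "rel_formula I' = \<psi>" by (simp add: I'_def)
        then have "Us \<in> interp (apply_interp \<tau> I' (tree_struct t)) R \<longleftrightarrow> holds (tree_struct t) Us (\<psi> R)"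
          using Us by (simp add: apply_interp_def univ')
        ultimately show ?thesis by (simp only:)
      qed
    qed
  qed
  ultimately show ?thesis unfolding E_def by blast
qed

end
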